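(* Suppose that for every even positive integer $N$, every positive integer $k$ and every $(k,N)$-necklace $X$ one has $T^{N-3k}X=X$ (equivalently, the length of every cycle in the directed graph $\mathrm{Neck}(k,N)$ divides $N-3k$). Then for every integer $n\ge 0$ there are polynomials $h_{4n+2}(t)$ and $h_{4n}(t)$ such that $$f_{4n+2}(t)=\frac{h_{4n+2}(t)}{(1+t^2)\cdot\big[(1-t^{8n-2})(1-t^{8n-8})(1-t^{8n-14})\cdots(1-t^{2n+4})\big]},$$ $$f_{4n}(t)=\frac{h_{4n}(t)}{(1-t^2)\cdot\big[(1-t^{8n-6})(1-t^{8n-12})(1-t^{8n-18})\cdots(1-t^{2n})\big]},$$ where in each bracket the exponents decrease by $6$ (so each bracket has exactly $n$ factors, and is $1$ for $n=0$).
   Context: $P_m$ is the path with $m$ vertices ($P_0$ empty); $C_n$ is the cycle with $n$ vertices, with $C_2=P_2$ and $C_0$ the empty graph. $P_m\times C_n$ is the Cartesian (grid) product. For a finite graph $G$, $Z(G)=1-\chi(\mathrm{Ind}(G))$, where $\mathrm{Ind}(G)$ is the complex of independent sets and $\chi$ the unreduced Euler characteristic; equivalently $Z(G)=\sum_\sigma(-1)^{|\sigma|}$ over all independent sets $\sigma$ including $\emptyset$. Define $f_n(t)=\sum_{m=0}^\infty Z(P_m\times C_n)t^m$. **Necklaces.** Let $n$ be an even positive integer and $k$ a positive integer. A $(k,n)$-necklace is a collection of $2k$ points (stones) on a circle of length $n$ with a stone vector from $\{-2,-1,1,2\}$ assigned to each stone. A positive (negative) vector points that many units clockwise (anti-clockwise)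 and the stone faces in that direction; its length is the absolute value. Conditions: consecutive stones face in opposite directions; if two consecutive stones face away from each other, their distance (along the arc between them) is an odd integer; if two consecutive stones face towards each other, their distance plus the lengths of their vectors is an odd integer, their distance is at least $3$, and if it is exactly $3$ then both vectors have length $1$. Necklaces differing by an isometry of the circle are identified. The transformation $T$ on $(k,n)$-necklaces: (JUMP) every stone moves along the circle by its vector; (TURN) vectors change by $-2\to1,\ -1\to2,\ 1\to-2,\ 2\to-1$; (FIX) if two stones are then at distance $3$ facing each other, any of their vectors of length $2$ is reduced to length $1$ (same direction). $\mathrm{Neck}(k,n)$ is the directed graph whose vertices are the isomorphism classes of $(k,n)$-necklaces, with an edge $N\to TN$ for each $N$; it is a disjoint union of directed cycles. $(k,n)$-necklaces exist only if $k\le n/4$. *)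

theory Defs
  imports
    "HOL-Computational_Algebra.Computational_Algebra"
    "HOL-Library.Real_Mod"
begin

section \<open>Graphs, independence complexes and the series \<open>f\<^sub>n\<close>\<close>

type_synonym 'a ugraph = "'a set \<times> 'a set set"

definition path_graph :: "nat \<Rightarrow> nat ugraph" where
  "path_graph m = ({..<m}, {{i, Suc i} | i. Suc i < m})"

text \<open>For \<open>n = 2\<close> the two directions of travel give the same unordered edge, so this is the path on
  two vertices. The guard makes the graph for \<open>n = 1\<close> a single vertex without a loop.\<close>
definition cycle_graph :: "nat \<Rightarrow> nat ugraph" where
  "cycle_graph n = ({..<n}, {{i, Suc i mod n} | i. i < n \<and> 2 \<le> n})"

definition cart_prod :: "'a ugraph \<Rightarrow> 'b ugraph \<Rightarrow> ('a \<times> 'b) ugraph" where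
  "cart_prod G H =
     (fst G \<times> fst H,
      {{u} \<times> e | u e. u \<in> fst G \<and> e \<in> snd H} \<union> {e \<times> {v} | e v. e \<in> snd G \<and> v \<in> fst H})"

definition Ind :: "'a ugraph \<Rightarrow> 'a set set" where
  "Ind G = {\<sigma>. \<sigma> \<subseteq> fst G \<and> (\<forall>e\<in>snd G. \<not> e \<subseteq> \<sigma>)}"

text \<open>Unreduced Euler characteristic of a finite simplicial complex given as its set of faces: a
  nonempty face \<open>\<sigma>\<close> has dimension \<open>card \<sigma> - 1\<close>, and the empty face does not count.\<close>
definition euler_char :: "'a set set \<Rightarrow> int" where
  "euler_char K = (\<Sum>\<sigma>\<in>K - {{}}. (-1) ^ (card \<sigma> - 1))"

definition Z :: "'a ugraph \<Rightarrow> int" where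
  "Z G = 1 - euler_char (Ind G)"

lemma Z_eq_sum_independent_sets:
  assumes "finite (fst G)" and "{} \<notin> snd G"
  shows   "Z G = (\<Sum>\<sigma>\<in>Ind G. (-1) ^ card \<sigma>)"
proof -
  have sub: "Ind G \<subseteq> Pow (fst G)"
    by (auto simp: Ind_def)
  hence fin: "finite (Ind G)"
    using assms(1) by (meson finite_Pow_iff finite_subset)
  have "{} \<in> Ind G"
    using assms(2) by (auto simp: Ind_def)
  hence "(\<Sum>\<sigma>\<in>Ind G. (-1) ^ card \<sigma>) = 1 + (\<Sum>\<sigma>\<in>Ind G - {{}}. (-1 :: int) ^ card \<sigma>)"
    using fin by (simp add: sum.remove)
  also have "(\<Sum>\<sigma>\<in>Ind G - {{}}. (-1 :: int) ^ card \<sigma>) = (\<Sum>\<sigma>\<in>Ind G - {{}}. - ((-1) ^ (card \<sigma> - 1)))"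
  proof (rule sum.cong[OF refl])
    fix \<sigma> assume "\<sigma> \<in> Ind G - {{}}"
    hence "\<sigma> \<subseteq> fst G" "\<sigma> \<noteq> {}"
      using sub by auto
    hence "finite \<sigma>" "\<sigma> \<noteq> {}"
      using assms(1) finite_subset by auto
    hence "card \<sigma> > 0"
      by (simp add: card_gt_0_iff)
    thus "(-1 :: int) ^ card \<sigma> = - ((-1) ^ (card \<sigma> - 1))"
      by (cases "card \<sigma>") auto
  qed
  finally show ?thesis
    by (simp add: Z_def euler_char_def sum_negf)
qed

definition f_series :: "nat \<Rightarrow> rat fps" where
  "f_series n = Abs_fps (\<lambda>m. of_int (Z (cart_prod (path_graph m) (cycle_graph n))))"


section \<open>Necklaces\<close>

text \<open>The circle of length \<open>n\<close> is the set of reals in \<open>{0..<n}\<close>, with arithmetic modulo \<open>n\<close>;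
  clockwise is the direction of increasing reals. A stone is a point of the circle together with
  its (signed) stone vector, and a configuration of stones is a set of such pairs.\<close>

type_synonym stone = "real \<times> int"

text \<open>Length of the arc that leads clockwise from the first stone to the second.\<close>
definition arc :: "nat \<Rightarrow> stone \<Rightarrow> stone \<Rightarrow> real" where
  "arc n s t = (fst t - fst s) rmod real n"

text \<open>\<open>t\<close> is the first stone met when travelling clockwise from \<open>s\<close>. A pair of stones may be
  consecutive in both orders (for two stones it always is), once for each of the two arcs.\<close>
definition next_stone :: "nat \<Rightarrow> stone set \<Rightarrow> stone \<Rightarrow> stone \<Rightarrow> bool" where
  "next_stone n X s t \<longleftrightarrow>
     s \<in> X \<and> t \<in> X \<and> s \<noteq> t \<and> (\<forall>u\<in>X. u \<noteq> s \<longrightarrow> arc n s t \<le> arc n s u)"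

text \<open>The next two relations refer to the clockwise arc from \<open>s\<close> to \<open>t\<close>.\<close>
definition face_away :: "stone \<Rightarrow> stone \<Rightarrow> bool" where
  "face_away s t \<longleftrightarrow> snd s < 0 \<and> 0 < snd t"

definition face_towards :: "stone \<Rightarrow> stone \<Rightarrow> bool" where
  "face_towards s t \<longleftrightarrow> 0 < snd s \<and> snd t < 0"

definition odd_integer :: "real \<Rightarrow> bool" where
  "odd_integer x \<longleftrightarrow> (\<exists>z::int. odd z \<and> x = of_int z)"

definition necklace :: "nat \<Rightarrow> nat \<Rightarrow> stone set \<Rightarrow> bool" where
  "necklace k n X \<longleftrightarrow>
     finite X \<and> card X = 2 * k \<and> inj_on fst X \<and>
     (\<forall>s\<in>X. 0 \<le> fst s \<and> fst s < real n \<and> snd s \<in> {-2, -1, 1, 2}) \<and>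
     (\<forall>s t. next_stone n X s t \<longrightarrow>
        sgn (snd t) = - sgn (snd s) \<and>
        (face_away s t \<longrightarrow> odd_integer (arc n s t)) \<and>
        (face_towards s t \<longrightarrow>
           odd_integer (arc n s t + of_int \<bar>snd s\<bar> + of_int \<bar>snd t\<bar>) \<and>
           arc n s t \<ge> 3 \<and>
           (arc n s t = 3 \<longrightarrow> \<bar>snd s\<bar> = 1 \<and> \<bar>snd t\<bar> = 1)))"

definition jump :: "nat \<Rightarrow> stone set \<Rightarrow> stone set" where
  "jump n X = (\<lambda>(p, v). ((p + of_int v) rmod real n, v)) ` X"

definition turn_vector :: "int \<Rightarrow> int" where
  "turn_vector v =
     (if v = -2 then 1 else if v = -1 then 2 else if v = 1 then -2 else if v = 2 then -1 else v)"

definition turn :: "stone set \<Rightarrow> stone set" where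
  "turn X = (\<lambda>(p, v). (p, turn_vector v)) ` X"

definition too_close :: "nat \<Rightarrow> stone set \<Rightarrow> stone \<Rightarrow> bool" where
  "too_close n X s \<longleftrightarrow>
     (\<exists>t\<in>X. (face_towards s t \<and> arc n s t = 3) \<or> (face_towards t s \<and> arc n t s = 3))"

text \<open>The vectors have length 1 or 2, so passing to the sign reduces a length 2 to 1 and keeps
  the direction.\<close>
definition fix_stones :: "nat \<Rightarrow> stone set \<Rightarrow> stone set" where
  "fix_stones n X = (\<lambda>s. if too_close n X s then (fst s, sgn (snd s)) else s) ` X"

definition T :: "nat \<Rightarrow> stone set \<Rightarrow> stone set" where
  "T n X = fix_stones n (turn (jump n X))"

text \<open>The isometries of the circle are the rotations and the reflections; a reflection swaps
  clockwise and anti-clockwise and hence negates the stone vectors.\<close>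

definition rotate_stones :: "nat \<Rightarrow> real \<Rightarrow> stone set \<Rightarrow> stone set" where
  "rotate_stones n c X = (\<lambda>(p, v). ((p + c) rmod real n, v)) ` X"

definition reflect_stones :: "nat \<Rightarrow> real \<Rightarrow> stone set \<Rightarrow> stone set" where
  "reflect_stones n c X = (\<lambda>(p, v). ((c - p) rmod real n, - v)) ` X"

text \<open>Necklaces are considered up to this relation: it is what equality of necklaces means.\<close>
definition same_necklace :: "nat \<Rightarrow> stone set \<Rightarrow> stone set \<Rightarrow> bool" where
  "same_necklace n X Y \<longleftrightarrow> (\<exists>c. Y = rotate_stones n c X \<or> Y = reflect_stones n c X)"

end

theory Submission
  imports Defs
begin

text \<open>
  Let the first row of a cylinder of even circumference \<open>N\<close> be cut down to a set \<open>P\<close> of pairwise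
  non-adjacent columns and let the second row have holes at \<open>H\<close>, disjoint from \<open>P\<close>. Every vertex in the first row is then a
  leaf, and leaf removal turns \<open>(P, H)\<close> into another such pair on a cylinder with one row less, at the
  cost of a sign. For a suitable class of pairs the boundaries of the runs of \<open>P\<close> form a necklace, and
  the passage to the next pair is JUMP followed by TURN. The FIX step amounts to dropping a hole \<open>p\<close>
  between two columns \<open>p - 2\<close> and \<open>p + 2\<close> of \<open>P\<close>, and the branching relation at \<open>p\<close> expresses the
  difference by a pair that has two stones less.

  So, modulo necklaces with fewer stones and polynomials, the series \<open>f\<close> of a \<open>(k, N)\<close>-necklace satisfies
  \<open>f = \<plusminus>t\<^sup>L f\<close> with \<open>L = N - 3k\<close>, because the \<open>L\<close>-th iterate of \<open>T\<close> is an isometric copy of it. By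
  induction on \<open>k\<close>, the factors \<open>1 - t\<^sup>2\<^sup>L\<close> clear its denominator, starting with the two alternating
  patterns for \<open>k = 0\<close>, which reproduce themselves after two rows with the sign \<open>(-1)\<^sup>N\<^sup>/\<^sup>2\<close>. Since
  \<open>4k \<le> N\<close>, at most \<open>N div 4\<close> factors occur, and branching over the odd columns of the first row writes
  the full cylinder as a combination of such pairs.
\<close>

section \<open>Alternating sums over independent sets\<close>

definition indep :: "('a \<Rightarrow> 'a \<Rightarrow> bool) \<Rightarrow> 'a set \<Rightarrow> bool" where
  "indep E \<sigma> \<longleftrightarrow> (\<forall>x\<in>\<sigma>. \<forall>y\<in>\<sigma>. \<not> E x y)"

definition ind_sum :: "('a \<Rightarrow> 'a \<Rightarrow> bool) \<Rightarrow> 'a set \<Rightarrow> int" where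
  "ind_sum E A = (\<Sum>\<sigma> | \<sigma> \<subseteq> A \<and> indep E \<sigma>. (-1) ^ card \<sigma>)"

definition cnbh :: "('a \<Rightarrow> 'a \<Rightarrow> bool) \<Rightarrow> 'a \<Rightarrow> 'a set" where
  "cnbh E v = {w. w = v \<or> E v w}"

text \<open>Independent sets are split by whether they contain \<open>v\<close>. Removing
  \<open>v\<close> from those that do is a bijection onto the independent sets avoiding its closed
  neighbourhood, and it flips the sign.\<close>

lemma ind_sum_branch:
  assumes "finite A" "v \<in> A" "symp E" "irreflp E"
  shows "ind_sum E A = ind_sum E (A - {v}) - ind_sum E (A - cnbh E v)"
proof -
  let ?S = "\<lambda>A. {\<sigma>. \<sigma> \<subseteq> A \<and> indep E \<sigma>}"
  have fin: "finite (?S B)" if "B \<subseteq> A" for B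
    using that assms(1) by (auto intro: finite_subset[of _ "Pow A"])
  have split: "?S A = ?S (A - {v}) \<union> insert v ` ?S (A - cnbh E v)"
  proof (intro equalityI subsetI)
    fix \<sigma> assume \<sigma>: "\<sigma> \<in> ?S A"
    show "\<sigma> \<in> ?S (A - {v}) \<union> insert v ` ?S (A - cnbh E v)"
    proof (cases "v \<in> \<sigma>")
      case True
      have "\<sigma> - {v} \<in> ?S (A - cnbh E v)"
        using \<sigma> True by (auto simp: indep_def cnbh_def)
      moreover have "\<sigma> = insert v (\<sigma> - {v})"
        using True by auto
      ultimately show ?thesis
        by blast
    qed (use \<sigma> in auto)
  next
    fix \<sigma> assume "\<sigma> \<in> ?S (A - {v}) \<union> insert v ` ?S (A - cnbh E v)"
    then consider "\<sigma> \<in> ?S (A - {v})" | \<tau> where "\<tau> \<in> ?S (A - cnbh E v)" "\<sigma> = insert v \<tau>"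
      by blast
    then show "\<sigma> \<in> ?S A"
    proof cases
      case 2
      have "\<not> E v w \<and> \<not> E w v" if "w \<in> \<tau>" for w
        using 2(1) that sympD[OF assms(3), of w v] by (auto simp: cnbh_def)
      moreover have "\<not> E v v"
        using assms(4) by (simp add: irreflp_def)
      ultimately show ?thesis
        using 2 assms(2) by (auto simp: indep_def)
    qed auto
  qed
  have disj: "?S (A - {v}) \<inter> insert v ` ?S (A - cnbh E v) = {}"
    by auto
  have inj: "inj_on (insert v) (?S (A - cnbh E v))"
  proof (rule inj_onI)
    fix \<sigma> \<tau> assume "\<sigma> \<in> ?S (A - cnbh E v)" "\<tau> \<in> ?S (A - cnbh E v)" "insert v \<sigma> = insert v \<tau>"
    moreover from this have "v \<notin> \<sigma>" "v \<notin> \<tau>"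
      by (auto simp: cnbh_def)
    ultimately show "\<sigma> = \<tau>"
      by (simp add: insert_ident)
  qed
  have "ind_sum E A = ind_sum E (A - {v}) + (\<Sum>\<sigma>\<in>insert v ` ?S (A - cnbh E v). (-1) ^ card \<sigma>)"
    unfolding ind_sum_def
    by (subst split, rule sum.union_disjoint) (use fin disj in \<open>auto simp del: insert_iff\<close>)
  also have "(\<Sum>\<sigma>\<in>insert v ` ?S (A - cnbh E v). (-1) ^ card \<sigma>)
      = (\<Sum>\<sigma>\<in>?S (A - cnbh E v). (-1 :: int) ^ card (insert v \<sigma>))"
    by (subst sum.reindex[OF inj]) simp
  also have "\<dots> = (\<Sum>\<sigma>\<in>?S (A - cnbh E v). - ((-1) ^ card \<sigma>))"
  proof (rule sum.cong[OF refl])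
    fix \<sigma> assume "\<sigma> \<in> ?S (A - cnbh E v)"
    then have "finite \<sigma>" "v \<notin> \<sigma>"
      using assms(1) by (auto simp: cnbh_def intro: finite_subset)
    then show "(-1 :: int) ^ card (insert v \<sigma>) = - ((-1) ^ card \<sigma>)"
      by simp
  qed
  finally show ?thesis
    by (simp add: ind_sum_def sum_negf)
qed

lemma ind_sum_isolated:
  assumes "finite A" "v \<in> A" "symp E" "irreflp E" "\<And>w. w \<in> A \<Longrightarrow> \<not> E v w"
  shows "ind_sum E A = 0"
proof -
  have "A - cnbh E v = A - {v}"
    using assms(5) by (auto simp: cnbh_def)
  then show ?thesis
    using ind_sum_branch[OF assms(1-4)] by simp
qed

text \<open>Branching at \<open>w\<close> leaves only the second term: once \<open>w\<close> is
  gone, \<open>u\<close> is isolated, and an isolated vertex makes the sum 0.\<close>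

lemma ind_sum_leaf:
  assumes "finite A" "u \<in> A" "w \<in> A" "symp E" "irreflp E" "E u w"
    and leaf: "\<And>x. x \<in> A \<Longrightarrow> E u x \<Longrightarrow> x = w"
  shows "ind_sum E A = - ind_sum E (A - cnbh E w)"
proof -
  have "u \<noteq> w"
    using assms(5,6) by (auto simp: irreflp_def)
  then have "u \<in> A - {w}" "\<And>x. x \<in> A - {w} \<Longrightarrow> \<not> E u x"
    using assms(2) leaf by blast+
  then have "ind_sum E (A - {w}) = 0"
    using assms(1,4,5) by (intro ind_sum_isolated[of _ u]) simp_all
  then show ?thesis
    using ind_sum_branch[OF assms(1,3,4,5)] by simp
qed

text \<open>Leaf removal is repeated over \<open>U\<close>. The last hypothesis ensures that
  removing the closed neighbourhood of one partner spares the other leaves and their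
  partners.\<close>

lemma ind_sum_leaves:
  assumes "finite U" "finite A" "symp E" "irreflp E" "U \<subseteq> A" "g ` U \<subseteq> A"
    and "\<And>u. u \<in> U \<Longrightarrow> E u (g u)"
    and "\<And>u x. u \<in> U \<Longrightarrow> x \<in> A \<Longrightarrow> E u x \<Longrightarrow> x = g u"
    and "\<And>u v. u \<in> U \<Longrightarrow> v \<in> U \<Longrightarrow> u \<noteq> v \<Longrightarrow> u \<notin> cnbh E (g v) \<and> g u \<notin> cnbh E (g v)"
  shows "ind_sum E A = (-1) ^ card U * ind_sum E (A - (\<Union>u\<in>U. cnbh E (g u)))"
  using assms(1,2,5-)
proof (induction U arbitrary: A rule: finite_induct)
  case (insert u U)
  have *: "ind_sum E A = - ind_sum E (A - cnbh E (g u))"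
    using insert.prems(2-5) by (intro ind_sum_leaf[of _ u "g u"] assms(3,4) insert.prems(1)) simp_all
  have "ind_sum E (A - cnbh E (g u))
      = (-1) ^ card U * ind_sum E (A - cnbh E (g u) - (\<Union>u\<in>U. cnbh E (g u)))"
  proof (rule insert.IH)
    have sep: "v \<notin> cnbh E (g u)" "g v \<notin> cnbh E (g u)" if "v \<in> U" for v
      using insert.prems(6)[of v u] insert.hyps(2) that by auto
    show "U \<subseteq> A - cnbh E (g u)" "g ` U \<subseteq> A - cnbh E (g u)"
      using insert.prems(2,3) sep by auto
    show "x = g v" if "v \<in> U" "x \<in> A - cnbh E (g u)" "E v x" for v x
      using insert.prems(5)[of v x] that by auto
    show "finite (A - cnbh E (g u))"
      using insert.prems(1) by simp
    show "E v (g v)" if "v \<in> U" for v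
      using insert.prems(4)[of v] that by simp
    show "v \<notin> cnbh E (g w) \<and> g v \<notin> cnbh E (g w)" if "v \<in> U" "w \<in> U" "v \<noteq> w" for v w
      using insert.prems(6)[of v w] that by simp
  qed
  then show ?case
    using * insert.hyps by (simp add: set_diff_eq conj_assoc)
qed simp

lemma ind_sum_image:
  assumes "inj_on \<phi> A" "\<And>x y. x \<in> A \<Longrightarrow> y \<in> A \<Longrightarrow> E' (\<phi> x) (\<phi> y) \<longleftrightarrow> E x y"
  shows "ind_sum E' (\<phi> ` A) = ind_sum E A"
  unfolding ind_sum_def
proof (rule sum.reindex_bij_betw[symmetric, THEN trans])
  show "bij_betw (image \<phi>) {\<sigma>. \<sigma> \<subseteq> A \<and> indep E \<sigma>} {\<sigma>. \<sigma> \<subseteq> \<phi> ` A \<and> indep E' \<sigma>}"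
  proof (rule bij_betwI')
    fix \<sigma> \<tau> assume "\<sigma> \<in> {\<sigma>. \<sigma> \<subseteq> A \<and> indep E \<sigma>}" "\<tau> \<in> {\<sigma>. \<sigma> \<subseteq> A \<and> indep E \<sigma>}"
    then show "(\<phi> ` \<sigma> = \<phi> ` \<tau>) = (\<sigma> = \<tau>)"
      using inj_on_image_eq_iff[OF assms(1), of \<sigma> \<tau>] by simp
  next
    fix \<sigma> assume "\<sigma> \<in> {\<sigma>. \<sigma> \<subseteq> A \<and> indep E \<sigma>}"
    then show "\<phi> ` \<sigma> \<in> {\<sigma>. \<sigma> \<subseteq> \<phi> ` A \<and> indep E' \<sigma>}"
      using assms(2) unfolding indep_def by blast
  next
    fix \<tau> assume "\<tau> \<in> {\<sigma>. \<sigma> \<subseteq> \<phi> ` A \<and> indep E' \<sigma>}"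
    then obtain \<sigma> where \<sigma>: "\<sigma> \<subseteq> A" "\<tau> = \<phi> ` \<sigma>"
      by (blast elim: subset_imageE)
    have "\<not> E x y" if "x \<in> \<sigma>" "y \<in> \<sigma>" for x y
    proof -
      have "\<phi> x \<in> \<tau>" "\<phi> y \<in> \<tau>"
        using that \<sigma>(2) by blast+
      then have "\<not> E' (\<phi> x) (\<phi> y)"
        using \<open>\<tau> \<in> _\<close> by (simp add: indep_def)
      then show ?thesis
        using assms(2) that \<sigma>(1) by blast
    qed
    then show "\<exists>\<sigma>\<in>{\<sigma>. \<sigma> \<subseteq> A \<and> indep E \<sigma>}. \<tau> = \<phi> ` \<sigma>"
      using \<sigma> by (auto simp: indep_def)
  qed
  show "(\<Sum>\<sigma> | \<sigma> \<subseteq> A \<and> indep E \<sigma>. (-1 :: int) ^ card (\<phi> ` \<sigma>))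
      = (\<Sum>\<sigma> | \<sigma> \<subseteq> A \<and> indep E \<sigma>. (-1) ^ card \<sigma>)"
  proof (rule sum.cong[OF refl])
    fix \<sigma> assume "\<sigma> \<in> {\<sigma>. \<sigma> \<subseteq> A \<and> indep E \<sigma>}"
    then have "inj_on \<phi> \<sigma>"
      using assms(1) by (auto intro: inj_on_subset)
    then show "(-1 :: int) ^ card (\<phi> ` \<sigma>) = (-1) ^ card \<sigma>"
      by (simp add: card_image)
  qed
qed

section \<open>Cylinders with two restricted rows\<close>

text \<open>What is left of row 1 after leaf removal along \<open>P\<close>. The set
  \<open>P\<close> itself becomes the set of holes in the row after it.\<close>

definition next_row :: "(int \<Rightarrow> bool) \<Rightarrow> (int \<Rightarrow> bool) \<Rightarrow> int \<Rightarrow> bool" where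
  "next_row P H i \<longleftrightarrow> \<not> H i \<and> \<not> P (i - 1) \<and> \<not> P i \<and> \<not> P (i + 1)"

section \<open>Congruences modulo the circumference and periodic column sets\<close>

locale even_cylinder =
  fixes N :: nat
  assumes N_even: "even N" and N_ge2: "2 \<le> N"
begin

abbreviation n :: int where "n \<equiv> int N"

definition eq_mod :: "int \<Rightarrow> int \<Rightarrow> bool" where
  "eq_mod i j \<longleftrightarrow> i mod n = j mod n"

lemma n_pos: "0 < n" and n_ge2: "2 \<le> n"
  using N_ge2 by auto

lemma eq_mod_refl [simp]: "eq_mod i i"
  by (simp add: eq_mod_def)

lemma eq_mod_sym: "eq_mod i j \<longleftrightarrow> eq_mod j i"
  by (auto simp: eq_mod_def)

lemma eq_mod_dvd: "eq_mod i j \<longleftrightarrow> n dvd i - j"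
  by (simp add: eq_mod_def mod_eq_dvd_iff)

lemma eq_mod_plus [simp]: "eq_mod (i + k) (j + k) \<longleftrightarrow> eq_mod i j" "eq_mod (i - k) (j - k) \<longleftrightarrow> eq_mod i j"
  by (simp_all add: eq_mod_dvd)

lemma eq_mod_move: "eq_mod (i - k) j \<longleftrightarrow> eq_mod i (j + k)" "eq_mod (i + k) j \<longleftrightarrow> eq_mod i (j - k)"
  by (simp_all add: eq_mod_dvd algebra_simps)

lemma not_eq_mod_Suc [simp]: "\<not> eq_mod (i + 1) i" "\<not> eq_mod i (i + 1)"
proof -
  have "\<not> n dvd 1"
    using n_ge2 by (simp add: zdvd_not_zless)
  then show "\<not> eq_mod (i + 1) i" "\<not> eq_mod i (i + 1)"
    by (simp_all add: eq_mod_dvd)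
qed

lemma eq_mod_range: "0 \<le> i \<Longrightarrow> i < n \<Longrightarrow> 0 \<le> j \<Longrightarrow> j < n \<Longrightarrow> eq_mod i j \<longleftrightarrow> i = j"
  by (simp add: eq_mod_def)

definition periodic :: "(int \<Rightarrow> 'a) \<Rightarrow> bool" where
  "periodic P \<longleftrightarrow> (\<forall>i. P (i + n) = P i)"

lemma periodic_mult:
  assumes "periodic P"
  shows "P (i + n * k) = P i"
proof -
  have *: "P (i + n * int j) = P i" for i j
  proof (induction j)
    case (Suc j)
    have "P (i + n * int (Suc j)) = P ((i + n * int j) + n)"
      by (simp add: algebra_simps)
    then show ?case
      using Suc assms by (simp add: periodic_def)
  qed simp
  show ?thesis
  proof (cases "0 \<le> k")
    case True
    then show ?thesis
      using *[of i "nat k"] by simp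
  next
    case False
    then show ?thesis
      using *[of "i + n * k" "nat (- k)"] by simp
  qed
qed

lemma periodic_eq_mod:
  assumes "periodic P" "eq_mod i j"
  shows "P i = P j"
proof -
  obtain k where "i - j = n * k"
    using assms(2) by (auto simp: eq_mod_dvd dvd_def)
  then have "i = j + n * k"
    by simp
  then show ?thesis
    using periodic_mult[OF assms(1)] by simp
qed

lemma eq_mod_mod [simp]: "eq_mod (i mod n) i" "eq_mod i (i mod n)"
  by (simp_all add: eq_mod_def)

lemma eq_mod_mod_iff [simp]: "eq_mod (i mod n) j \<longleftrightarrow> eq_mod i j" "eq_mod j (i mod n) \<longleftrightarrow> eq_mod j i"
  by (simp_all add: eq_mod_def)

lemma periodic_mod [simp]: "periodic P \<Longrightarrow> P (i mod n) = P i"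
  using periodic_eq_mod[of P "i mod n" i] by simp

lemma periodic_eqmI: "periodic (\<lambda>i. eq_mod i p)"
  by (simp add: periodic_def eq_mod_def)

lemma periodic_shift:
  assumes "periodic P"
  shows "periodic (\<lambda>i. P (i + c))" "periodic (\<lambda>i. P (i - c))" "periodic (\<lambda>i. P (c - i))"
proof -
  show "periodic (\<lambda>i. P (i + c))" "periodic (\<lambda>i. P (i - c))"
    unfolding periodic_def by (safe intro!: periodic_eq_mod[OF assms], simp_all add: eq_mod_dvd)
  show "periodic (\<lambda>i. P (c - i))"
    unfolding periodic_def by (safe intro!: periodic_eq_mod[OF assms], simp_all add: eq_mod_dvd)
qed

lemma periodic_bool:
  "periodic P \<Longrightarrow> periodic (\<lambda>i. \<not> P i)"
  "periodic P \<Longrightarrow> periodic Q \<Longrightarrow> periodic (\<lambda>i. P i \<and> Q i)"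
  "periodic P \<Longrightarrow> periodic Q \<Longrightarrow> periodic (\<lambda>i. P i \<or> Q i)"
  by (simp_all add: periodic_def)

lemmas periodic_intros = periodic_bool periodic_shift periodic_eqmI

section \<open>Cylinder graphs and leaf removal\<close>

definition adj :: "nat \<times> int \<Rightarrow> nat \<times> int \<Rightarrow> bool" where
  "adj x y \<longleftrightarrow>
     (fst x = fst y \<and> (eq_mod (snd x) (snd y + 1) \<or> eq_mod (snd y) (snd x + 1))) \<or>
     (snd x = snd y \<and> (fst x = Suc (fst y) \<or> fst y = Suc (fst x)))"

lemma adj_symp: "symp adj"
  by (auto simp: symp_def adj_def)

lemma adj_irreflp: "irreflp adj"
  by (simp add: irreflp_def adj_def)

text \<open>The cylinder with rows \<open>0, \<dots>, m - 1\<close>, where row 0 is cut down to the columns in \<open>P\<close> and row 1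
  has holes at the columns in \<open>H\<close>; the column sets are given as \<open>N\<close>-periodic predicates on the
  integers.\<close>

definition graph :: "nat \<Rightarrow> (int \<Rightarrow> bool) \<Rightarrow> (int \<Rightarrow> bool) \<Rightarrow> (nat \<times> int) set" where
  "graph m P H = {(r, c). r < m \<and> 0 \<le> c \<and> c < n \<and> (r = 0 \<longrightarrow> P c) \<and> (r = 1 \<longrightarrow> \<not> H c)}"

definition grid_sum :: "nat \<Rightarrow> (int \<Rightarrow> bool) \<Rightarrow> (int \<Rightarrow> bool) \<Rightarrow> int" where
  "grid_sum m P H = ind_sum adj (graph m P H)"

lemma finite_graph: "finite (graph m P H)"
  by (rule finite_subset[of _ "{..<m} \<times> {0..<n}"]) (auto simp: graph_def)

definition count_period :: "(int \<Rightarrow> bool) \<Rightarrow> nat" where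
  "count_period P = card {c. 0 \<le> c \<and> c < n \<and> P c}"

lemma finite_period: "finite {c. 0 \<le> c \<and> c < n \<and> P c}"
  by (rule finite_subset[of _ "{0..<n}"]) auto

lemma eq_mod_neighbour:
  assumes "eq_mod i j \<or> eq_mod i (j + 1) \<or> eq_mod j (i + 1)"
  shows "eq_mod j i \<or> eq_mod j (i - 1) \<or> eq_mod j (i + 1)"
  using assms by (auto simp: eq_mod_sym eq_mod_move(2)[symmetric])

text \<open>The vertices of row 0 are leaves hanging on row 1. Removing the closed neighbourhoods of their
  partners exhausts row 0, so the same kind of graph remains, shorter by one row.\<close>

lemma grid_sum_step:
  assumes per: "periodic P" "periodic H" and P: "\<And>i. P i \<Longrightarrow> \<not> P (i + 1) \<and> \<not> H i" and "1 \<le> m"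
  shows "grid_sum (Suc m) P H = (-1) ^ count_period P * grid_sum m (next_row P H) P"
proof -
  let ?Q = "{c. 0 \<le> c \<and> c < n \<and> P c}"
  define U where "U = Pair (0 :: nat) ` ?Q"
  define g where "g = (\<lambda>x :: nat \<times> int. (1 :: nat, snd x))"
  \<comment> \<open>No two columns of \<open>P\<close> are adjacent, even across the seam, so the
    only neighbour of a vertex in row 0 is the one in row 1.\<close>
  have isol: "\<not> eq_mod c (d + 1)" if "P c" "P d" for c d
    using periodic_eq_mod[OF per(1), of c "d + 1"] P that by blast
  have U: "\<exists>c. u = (0, c) \<and> 0 \<le> c \<and> c < n \<and> P c" if "u \<in> U" for u
    using that by (auto simp: U_def)
  have "grid_sum (Suc m) P H
      = (-1) ^ card U * ind_sum adj (graph (Suc m) P H - (\<Union>u\<in>U. cnbh adj (g u)))"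
    unfolding grid_sum_def
  proof (rule ind_sum_leaves[OF _ finite_graph adj_symp adj_irreflp])
    show "finite U"
      by (simp add: U_def finite_period)
    show "U \<subseteq> graph (Suc m) P H" "g ` U \<subseteq> graph (Suc m) P H"
      using P \<open>1 \<le> m\<close> by (auto simp: U_def graph_def g_def)
    show "adj u (g u)" if "u \<in> U" for u
      using U[OF that] by (auto simp: g_def adj_def)
    show "x = g u" if u: "u \<in> U" and x: "x \<in> graph (Suc m) P H" "adj u x" for u x
    proof -
      obtain c where c: "u = (0, c)" "P c"
        using U[OF u] by blast
      obtain r d where d: "x = (r, d)"
        by (cases x)
      have "r \<noteq> 0"
        using x c isol[of c d] isol[of d c] by (auto simp: d adj_def graph_def)
      then show ?thesis
        using x(2) by (auto simp: c d adj_def g_def)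
    qed
    show "u \<notin> cnbh adj (g v) \<and> g u \<notin> cnbh adj (g v)" if uv: "u \<in> U" "v \<in> U" "u \<noteq> v" for u v
    proof -
      obtain c d where cd: "u = (0, c)" "P c" "v = (0, d)" "P d"
        using U[OF uv(1)] U[OF uv(2)] by blast
      then show ?thesis
        using isol[of c d] isol[of d c] uv(3) by (auto simp: cnbh_def adj_def g_def)
    qed
  qed
  also have "card U = count_period P"
    unfolding U_def count_period_def by (rule card_image) (simp add: inj_on_def)
  \<comment> \<open>The removed neighbourhoods contain all of row 0, the columns of row 1 within
    distance 1 of \<open>P\<close>, and the columns \<open>P\<close> of row 2. Renumbering the
    remaining rows gives the new pair.\<close>
  also have "graph (Suc m) P H - (\<Union>u\<in>U. cnbh adj (g u))
      = (\<lambda>(r, c). (Suc r, c)) ` graph m (next_row P H) P" (is "?L = ?R")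
  proof -
    have near: "(\<exists>u\<in>U. (1, c) \<in> cnbh adj (g u)) \<longleftrightarrow> P (c - 1) \<or> P c \<or> P (c + 1)"
      if c: "0 \<le> c" "c < n" for c
    proof
      assume "\<exists>u\<in>U. (1, c) \<in> cnbh adj (g u)"
      then obtain d where "P d" "eq_mod c d \<or> eq_mod c (d + 1) \<or> eq_mod d (c + 1)"
        by (auto simp: U_def cnbh_def adj_def g_def)
      then show "P (c - 1) \<or> P c \<or> P (c + 1)"
        using eq_mod_neighbour[of c d] periodic_eq_mod[OF per(1)] by blast
    next
      assume "P (c - 1) \<or> P c \<or> P (c + 1)"
      then obtain d where "P d" "eq_mod c d \<or> eq_mod c (d + 1) \<or> eq_mod d (c + 1)"
        using eq_mod_refl[of c] by (metis diff_add_cancel eq_mod_refl)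
      then have d: "P (d mod n)" "c = d mod n \<or> eq_mod c (d mod n + 1) \<or> eq_mod (d mod n) (c + 1)"
        using c per(1) n_pos
        by (simp_all add: eq_mod_range[of c "d mod n", symmetric] eq_mod_move(2)[symmetric]
            eq_mod_def[of c "_ + 1"] mod_add_left_eq)
      show "\<exists>u\<in>U. (1, c) \<in> cnbh adj (g u)"
        by (rule bexI[of _ "(0, d mod n)"])
          (use d n_pos in \<open>auto simp: U_def cnbh_def adj_def g_def\<close>)
    qed
    have row0: "(\<exists>u\<in>U. (0, c) \<in> cnbh adj (g u)) \<longleftrightarrow> 0 \<le> c \<and> c < n \<and> P c" for c
      by (auto simp: U_def cnbh_def adj_def g_def)
    have row2: "(\<exists>u\<in>U. (2, c) \<in> cnbh adj (g u)) \<longleftrightarrow> 0 \<le> c \<and> c < n \<and> P c" for c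
      by (auto simp: U_def cnbh_def adj_def g_def)
    have row3: "\<not> (\<exists>u\<in>U. (Suc (Suc (Suc r)), c) \<in> cnbh adj (g u))" for r c
      by (auto simp: U_def cnbh_def adj_def g_def)
    have "(r, c) \<in> ?L \<longleftrightarrow> (r, c) \<in> ?R" for r c
    proof -
      consider "r = 0" | "r = 1" | "r = 2" | s where "r = Suc (Suc (Suc s))"
        by (metis One_nat_def Suc_1 not0_implies_Suc)
      then show ?thesis
      proof cases
        case 1
        then show ?thesis
          using row0[of c] by (auto simp: graph_def)
      next
        case 2
        then show ?thesis
          using near[of c] \<open>1 \<le> m\<close> by (auto simp: graph_def next_row_def image_iff)
      next
        case 3
        then show ?thesis
          using row2[of c] by (auto simp: graph_def image_iff)
      next
        case 4
        then show ?thesis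
          using row3[of s c] by (auto simp: graph_def image_iff)
      qed
    qed
    then show ?thesis
      by (intro set_eqI) (metis surj_pair)
  qed
  also have "ind_sum adj ?R = grid_sum m (next_row P H) P"
    unfolding grid_sum_def by (rule ind_sum_image) (auto simp: inj_on_def adj_def)
  finally show ?thesis .
qed

section \<open>Branching at a column and symmetries of the cylinder\<close>

definition del_col :: "int \<Rightarrow> (int \<Rightarrow> bool) \<Rightarrow> int \<Rightarrow> bool" where
  "del_col p P i \<longleftrightarrow> P i \<and> \<not> eq_mod i p"

definition ins_col :: "int \<Rightarrow> (int \<Rightarrow> bool) \<Rightarrow> int \<Rightarrow> bool" where
  "ins_col p P i \<longleftrightarrow> P i \<or> eq_mod i p"

definition del_col_near :: "int \<Rightarrow> (int \<Rightarrow> bool) \<Rightarrow> int \<Rightarrow> bool" where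
  "del_col_near p P i \<longleftrightarrow> P i \<and> \<not> eq_mod i p \<and> \<not> eq_mod i (p - 1) \<and> \<not> eq_mod i (p + 1)"

lemma periodic_del_col_ins_col [simp]:
  "periodic P \<Longrightarrow> periodic (del_col p P)" "periodic P \<Longrightarrow> periodic (ins_col p P)"
  "periodic P \<Longrightarrow> periodic (del_col_near p P)"
  unfolding del_col_def[abs_def] ins_col_def[abs_def] del_col_near_def[abs_def]
  by (intro periodic_intros; assumption)+

text \<open>The closed neighbourhood of \<open>p\<close> in row 0 consists of \<open>p - 1\<close>,
  \<open>p\<close>, \<open>p + 1\<close> in row 0 and of \<open>p\<close> in row 1, which becomes a
  hole.\<close>

lemma grid_sum_branch:
  assumes per: "periodic P" "periodic H" and p: "P p" "\<not> H p" and "2 \<le> m"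
  shows "grid_sum m P H = grid_sum m (del_col p P) H - grid_sum m (del_col_near p P) (ins_col p H)"
proof -
  let ?v = "(0 :: nat, p mod n)"
  have "?v \<in> graph m P H"
    using assms n_pos by (simp add: graph_def)
  then have "grid_sum m P H = ind_sum adj (graph m P H - {?v}) - ind_sum adj (graph m P H - cnbh adj ?v)"
    unfolding grid_sum_def by (intro ind_sum_branch finite_graph adj_symp adj_irreflp)
  also have "graph m P H - {?v} = graph m (del_col p P) H"
  proof -
    have "eq_mod c p \<longleftrightarrow> c = p mod n" if "0 \<le> c" "c < n" for c
      using that n_pos eq_mod_range[of c "p mod n"] by simp
    then show ?thesis
      by (auto simp: graph_def del_col_def)
  qed
  also have "graph m P H - cnbh adj ?v = graph m (del_col_near p P) (ins_col p H)"
  proof -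
    have "eq_mod c p \<longleftrightarrow> c = p mod n" if "0 \<le> c" "c < n" for c
      using that n_pos eq_mod_range[of c "p mod n"] by simp
    moreover have "eq_mod (p mod n) (c + 1) \<longleftrightarrow> eq_mod c (p - 1)" for c
      by (simp add: eq_mod_move(2)[symmetric] eq_mod_sym)
    moreover have "eq_mod c (p mod n + 1) \<longleftrightarrow> eq_mod c (p + 1)" for c
      by (simp add: eq_mod_def mod_add_left_eq)
    ultimately show ?thesis
      by (auto simp: graph_def del_col_near_def ins_col_def cnbh_def adj_def)
  qed
  finally show ?thesis
    by (simp add: grid_sum_def)
qed

text \<open>The branching relation read backwards: it is applied to the row with \<open>p\<close>
  inserted, where deleting \<open>p\<close> and deleting its neighbourhood both give back
  \<open>P\<close>, the latter with the hole at \<open>p\<close>.\<close>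

lemma grid_sum_unhole:
  assumes per: "periodic P" "periodic H" and "H p" "\<not> P p" "\<not> P (p - 1)" "\<not> P (p + 1)" "2 \<le> m"
  shows "grid_sum m P H = grid_sum m P (del_col p H) - grid_sum m (ins_col p P) (del_col p H)"
proof -
  have "grid_sum m (ins_col p P) (del_col p H)
      = grid_sum m (del_col p (ins_col p P)) (del_col p H) - grid_sum m (del_col_near p (ins_col p P)) (ins_col p (del_col p H))"
    by (rule grid_sum_branch) (use assms in \<open>auto simp: ins_col_def del_col_def\<close>)
  also have "del_col p (ins_col p P) = P"
    using assms(4) periodic_eq_mod[OF per(1)] by (auto simp: fun_eq_iff ins_col_def del_col_def)
  also have "del_col_near p (ins_col p P) = P"
    using assms(4-6) periodic_eq_mod[OF per(1)] by (auto simp: fun_eq_iff ins_col_def del_col_near_def)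
  also have "ins_col p (del_col p H) = H"
    using assms(3) periodic_eq_mod[OF per(2)] by (auto simp: fun_eq_iff ins_col_def del_col_def)
  finally show ?thesis
    by simp
qed

lemma grid_sum_isometry:
  assumes per: "periodic P" "periodic H" and s: "s = 1 \<or> s = -1"
  shows "grid_sum m (\<lambda>i. P (s * i + c)) (\<lambda>i. H (s * i + c)) = grid_sum m P H"
proof -
  have ss: "s * (s * i) = i" for i
    using s by auto
  have lin: "eq_mod (s * i + c) (s * j + c) \<longleftrightarrow> eq_mod i j" for i j
    using s by (auto simp: eq_mod_dvd dvd_diff_commute)
  have lin1: "eq_mod (s * i + c) (s * j + c + 1) \<longleftrightarrow> eq_mod i (j + s)" for i j
  proof -
    have "s * j + c + 1 = s * (j + s) + c"
      using s by auto
    then show ?thesis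
      by (metis lin)
  qed
  define \<phi> where "\<phi> = (\<lambda>(r :: nat, i). (r, (s * i + c) mod n))"
  have "graph m P H = \<phi> ` graph m (\<lambda>i. P (s * i + c)) (\<lambda>i. H (s * i + c))" (is "_ = _ ` ?G")
  proof (intro equalityI subsetI)
    fix x assume x: "x \<in> graph m P H"
    obtain r i where i: "x = (r, i)"
      by (cases x)
    have "eq_mod (s * ((s * (i - c)) mod n) + c) i"
    proof -
      have "eq_mod (s * ((s * (i - c)) mod n) + c) (s * (s * (i - c)) + c)"
        using lin by (metis eq_mod_mod(1))
      then show ?thesis
        by (simp add: ss)
    qed
    note e = this
    have "(r, (s * (i - c)) mod n) \<in> ?G"
      using x n_pos periodic_eq_mod[OF per(1) e] periodic_eq_mod[OF per(2) e] by (auto simp: i graph_def)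
    moreover have "\<phi> (r, (s * (i - c)) mod n) = x"
      using e x n_pos by (simp add: \<phi>_def i eq_mod_def graph_def)
    ultimately show "x \<in> \<phi> ` ?G"
      by (metis imageI)
  next
    fix x assume "x \<in> \<phi> ` ?G"
    then show "x \<in> graph m P H"
      using n_pos per by (auto simp: \<phi>_def graph_def)
  qed
  moreover have "ind_sum adj (\<phi> ` ?G) = ind_sum adj ?G"
  proof (rule ind_sum_image)
    show "inj_on \<phi> ?G"
    proof (rule inj_onI)
      fix x y assume xy: "x \<in> ?G" "y \<in> ?G" "\<phi> x = \<phi> y"
      then have "fst x = fst y" "eq_mod (s * snd x + c) (s * snd y + c)"
        by (auto simp: \<phi>_def eq_mod_def split: prod.splits)
      then have "eq_mod (snd x) (snd y)"
        using lin by blast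
      then show "x = y"
        using xy(1,2) \<open>fst x = fst y\<close> eq_mod_range[of "snd x" "snd y"]
        by (auto simp: graph_def)
    qed
    fix x y assume xy: "x \<in> ?G" "y \<in> ?G"
    obtain r i r' j where ij: "x = (r, i)" "y = (r', j)"
      by (cases x, cases y)
    have 1: "((s * i + c) mod n = (s * j + c) mod n) \<longleftrightarrow> i = j"
      using lin[of i j] xy eq_mod_range[of i j] by (auto simp: ij eq_mod_def graph_def)
    have 2: "eq_mod (s * i + c) ((s * j + c) mod n + 1) \<longleftrightarrow> eq_mod i (j + s)" for i j
      using lin1[of i j] by (simp add: eq_mod_def mod_add_left_eq)
    \<comment> \<open>A reflection interchanges the two orientations of a horizontal edge, so the
      two alternatives are compared as a disjunction.\<close>
    have 3: "eq_mod i (j + s) \<or> eq_mod j (i + s) \<longleftrightarrow> eq_mod i (j + 1) \<or> eq_mod j (i + 1)"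
    proof -
      have "eq_mod i (j - 1) \<longleftrightarrow> eq_mod j (i + 1)" "eq_mod j (i - 1) \<longleftrightarrow> eq_mod i (j + 1)"
        using dvd_diff_commute[of n i "j - 1"] dvd_diff_commute[of n j "i - 1"]
        by (simp_all add: eq_mod_dvd algebra_simps)
      then show ?thesis
        using s by auto
    qed
    show "adj (\<phi> x) (\<phi> y) \<longleftrightarrow> adj x y"
      using 3 by (simp add: \<phi>_def ij adj_def 1 2)
  qed
  ultimately show ?thesis
    by (simp add: grid_sum_def)
qed

end

section \<open>States that come from necklaces\<close>

text \<open>Call the elements of \<open>P\<close> and \<open>H\<close> marks. In a good state two consecutive marks of the same kind are
  at distance 2, marks of different kinds at distance 2 or 3, and two elements of \<open>P\<close> may also be at
  distance 4. Maximal runs of \<open>P\<close> are the arcs between stones that face away from each other, and the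
  stretches between them (runs of \<open>H\<close>, possibly empty) are those between stones facing each other.\<close>

definition good_at :: "(int \<Rightarrow> bool) \<Rightarrow> (int \<Rightarrow> bool) \<Rightarrow> int \<Rightarrow> bool" where
  "good_at P H i \<longleftrightarrow>
     (P i \<longrightarrow> \<not> P (i + 1) \<and> \<not> H (i - 1) \<and> \<not> H i \<and> \<not> H (i + 1)) \<and>
     (P i \<longrightarrow> P (i + 2) \<or> H (i + 2) \<or> H (i + 3) \<or> P (i + 4)) \<and>
     (P i \<longrightarrow> P (i - 2) \<or> H (i - 2) \<or> H (i - 3) \<or> P (i - 4)) \<and>
     (H i \<longrightarrow> \<not> H (i + 1)) \<and>
     (H i \<longrightarrow> H (i + 2) \<or> P (i + 2) \<or> P (i + 3)) \<and>
     (H i \<longrightarrow> H (i - 2) \<or> P (i - 2) \<or> P (i - 3)) \<and>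
     (P i \<or> H i \<or> P (i + 1) \<or> H (i + 1) \<or> P (i + 2) \<or> H (i + 2) \<or> P (i + 3) \<or> H (i + 3))"

definition good :: "(int \<Rightarrow> bool) \<Rightarrow> (int \<Rightarrow> bool) \<Rightarrow> bool" where
  "good P H \<longleftrightarrow> (\<forall>i. good_at P H i)"

lemma good_shift:
  assumes "good P H"
  shows "good (\<lambda>i. P (c + i)) (\<lambda>i. H (c + i))"
proof -
  have "good_at (\<lambda>i. P (c + i)) (\<lambda>i. H (c + i)) i = good_at P H (c + i)" for i
    by (simp add: good_at_def algebra_simps)
  then show ?thesis
    using assms by (simp add: good_def)
qed

text \<open>By translation it suffices to look at position 0, where every condition concerns a
  finite window of marks and becomes propositional.\<close>

lemma goodI:
  assumes "\<And>c. good_at (\<lambda>i. P (c + i)) (\<lambda>i. H (c + i)) 0"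
  shows "good P H"
proof -
  have "good_at (\<lambda>i. P (c + i)) (\<lambda>i. H (c + i)) 0 = good_at P H c" for c
    by (simp add: good_at_def)
  then show ?thesis
    using assms by (simp add: good_def)
qed

lemmas good_window = good_def[THEN iffD1, THEN spec, unfolded good_at_def]

text \<open>An isolated hole between two elements of \<open>P\<close> at distance 4 corresponds to two stones at distance 3
  that face each other with vectors of length 2; this is what the FIX step of \<^term>\<open>T\<close> repairs.\<close>

definition fixed :: "(int \<Rightarrow> bool) \<Rightarrow> (int \<Rightarrow> bool) \<Rightarrow> bool" where
  "fixed P H \<longleftrightarrow> (\<forall>i. H i \<longrightarrow> \<not> (P (i - 2) \<and> P (i + 2)))"

lemmas fixed_window = fixed_def[THEN iffD1, THEN spec]

lemma fixed_shift:
  assumes "fixed P H"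
  shows "fixed (\<lambda>i. P (c + i)) (\<lambda>i. H (c + i))"
proof -
  have "H (c + i) \<longrightarrow> \<not> (P (c + (i - 2)) \<and> P (c + (i + 2)))" for i
    using fixed_window[OF assms, of "c + i"] by (simp add: algebra_simps)
  then show ?thesis
    by (simp add: fixed_def)
qed

lemma good_next_row_at:
  assumes "good P H" "fixed P H"
  shows "good_at (next_row P H) P 0"
  using good_window[OF assms(1), of "-3"] good_window[OF assms(1), of "-2"] 
     good_window[OF assms(1), of "-1"] good_window[OF assms(1), of "0"] good_window[OF assms(1), of "1"]
     good_window[OF assms(1), of "2"] good_window[OF assms(1), of "3"] fixed_window[OF assms(2), of "2"]
     fixed_window[OF assms(2), of "-2"]
    unfolding good_at_def next_row_def
    by (simp del: de_Morgan_disj de_Morgan_conj) satx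

lemma good_next_row:
  assumes "good P H" "fixed P H"
  shows "good (next_row P H) P"
proof (rule goodI)
  fix c
  let ?P = "\<lambda>i. P (c + i)" and ?H = "\<lambda>i. H (c + i)"
  have "next_row P H (c + i) = next_row ?P ?H i" for i
    by (simp add: next_row_def algebra_simps)
  then show "good_at (\<lambda>i. next_row P H (c + i)) ?P 0"
    using good_next_row_at[OF good_shift fixed_shift, OF assms, of c] by simp
qed

text \<open>For holes with elements of \<open>P\<close> at distance 2 on both sides, both outcomes
  of branching stay good: dropping the hole leaves a gap of 4 in \<open>P\<close>, moving it into
  \<open>P\<close> fills the gap with steps of 2. \<open>R\<close> may be one residue class or all
  such holes.\<close>

lemma good_unhole:
  assumes "good P H" and R: "\<And>i. R i \<Longrightarrow> H i \<and> P (i - 2) \<and> P (i + 2)"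
  shows "good P (\<lambda>i. H i \<and> \<not> R i)" "good (\<lambda>i. P i \<or> R i) (\<lambda>i. H i \<and> \<not> R i)"
proof -
  have *: "good_at P (\<lambda>i. H i \<and> \<not> R i) 0 \<and> good_at (\<lambda>i. P i \<or> R i) (\<lambda>i. H i \<and> \<not> R i) 0"
    if "good P H" and "\<And>i. R i \<longrightarrow> H i \<and> P (i - 2) \<and> P (i + 2)" for P H R
    using good_window[OF that(1), of "-2"] good_window[OF that(1), of "-1"]
      good_window[OF that(1), of "0"] good_window[OF that(1), of "1"] good_window[OF that(1), of "2"]
      that(2)[of "-3"] that(2)[of "-2"] that(2)[of "-1"] that(2)[of 0] that(2)[of 1] that(2)[of 2] that(2)[of 3]
    unfolding good_at_def
    by (simp del: de_Morgan_disj de_Morgan_conj) satx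
  have R': "R (c + i) \<longrightarrow> H (c + i) \<and> P (c + (i - 2)) \<and> P (c + (i + 2))" for c i
    using R[of "c + i"] by (simp add: algebra_simps)
  show "good P (\<lambda>i. H i \<and> \<not> R i)"
    by (rule goodI, rule *[THEN conjunct1], rule good_shift[OF assms(1)])
      (rule R')
  show "good (\<lambda>i. P i \<or> R i) (\<lambda>i. H i \<and> \<not> R i)"
    by (rule goodI, rule *[THEN conjunct2], rule good_shift[OF assms(1)])
      (rule R')
qed

definition fixH :: "(int \<Rightarrow> bool) \<Rightarrow> (int \<Rightarrow> bool) \<Rightarrow> int \<Rightarrow> bool" where
  "fixH P H i \<longleftrightarrow> H i \<and> \<not> (P (i - 2) \<and> P (i + 2))"

lemma fixed_fixH: "fixed P (fixH P H)"
  by (simp add: fixed_def fixH_def)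

lemma good_fixH:
  assumes "good P H"
  shows "good P (fixH P H)"
proof -
  have "fixH P H = (\<lambda>i. H i \<and> \<not> (H i \<and> P (i - 2) \<and> P (i + 2)))"
    by (auto simp: fixH_def)
  then show ?thesis
    using good_unhole(1)[OF assms, of "\<lambda>i. H i \<and> P (i - 2) \<and> P (i + 2)"] by simp
qed

text \<open>The stone vector at position \<open>i\<close>, with 0 for no stone. A run \<open>p, p + 2, \<dots>, q\<close> of \<open>P\<close> has stones
  at \<open>p\<close> and \<open>q + 1\<close>, whose lengths record whether the next hole is at distance 2 or 3.\<close>

definition stone_vec :: "(int \<Rightarrow> bool) \<Rightarrow> (int \<Rightarrow> bool) \<Rightarrow> int \<Rightarrow> int" where
  "stone_vec P H i =
     (if P i \<and> \<not> P (i - 2) then if H (i - 2) then -2 else -1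
      else if P (i - 1) \<and> \<not> P (i + 1) then if H (i + 1) then 2 else 1 else 0)"

lemma stone_vec_shift: "stone_vec (\<lambda>i. P (c + i)) (\<lambda>i. H (c + i)) i = stone_vec P H (c + i)"
  by (simp add: stone_vec_def algebra_simps)

text \<open>A run from \<open>p\<close> to \<open>q\<close> has its stones at \<open>p\<close> and
  \<open>q + 1\<close>, so reflecting stones by \<open>c - i\<close> corresponds to reflecting
  columns by \<open>c - 1 - i\<close>.\<close>

lemma stone_vec_reflect:
  assumes "good P H"
  shows "stone_vec (\<lambda>i. P (c - 1 - i)) (\<lambda>i. H (c - 1 - i)) i = - stone_vec P H (c - i)"
  using good_window[OF assms, of "c - i - 1"] by (auto simp: stone_vec_def algebra_simps)

lemma stone_vec_range: "stone_vec P H i \<in> {-2, -1, 0, 1, 2}"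
  by (simp add: stone_vec_def)

lemma stone_vec_neg_iff: "stone_vec P H i < 0 \<longleftrightarrow> P i \<and> \<not> P (i - 2)"
  by (simp add: stone_vec_def)

lemma stone_vec_pos_iff:
  assumes "good P H"
  shows "stone_vec P H i > 0 \<longleftrightarrow> P (i - 1) \<and> \<not> P (i + 1)"
  using good_window[OF assms, of "i - 1"] by (auto simp: stone_vec_def)

text \<open>One case per vector. For instance, the vector -2 at 0 comes with a hole at -2. In the
  next row a run then ends at -3, so a positive stone sits at -2; as -1 is not in \<open>P\<close>,
  the new set of holes, its length is 1.\<close>

lemma stone_vec_jump_at:
  assumes "good P H" "fixed P H" "stone_vec P H 0 \<noteq> 0"
  shows "stone_vec (next_row P H) P (stone_vec P H 0) = turn_vector (stone_vec P H 0)"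
proof -
  note W = good_window[OF assms(1)] and X = fixed_window[OF assms(2)]
  consider "P 0" "\<not> P (-2)" "H (-2)" | "P 0" "\<not> P (-2)" "\<not> H (-2)"
    | "P (-1)" "\<not> P 1" "H 1" | "P (-1)" "\<not> P 1" "\<not> H 1"
    using assms(3) by (auto simp: stone_vec_def split: if_splits)
  then show ?thesis
  proof cases
    case 1
    then have "next_row P H (-3) \<and> \<not> next_row P H (-1) \<and> \<not> next_row P H (-2) \<and> \<not> P (-1)"
      using W[of "-3"] W[of "-2"] W[of "-1"] W[of 0] X[of "-2"] by (auto simp: next_row_def)
    then show ?thesis
      using 1 by (simp add: stone_vec_def turn_vector_def)
  next
    case 2
    then have "next_row P H (-2) \<and> \<not> next_row P H 0 \<and> \<not> next_row P H (-1)"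
      using W[of "-3"] W[of "-1"] W[of 0] by (auto simp: next_row_def)
    then show ?thesis
      using 2 by (simp add: stone_vec_def turn_vector_def)
  next
    case 3
    then have "next_row P H 2 \<and> \<not> next_row P H 0 \<and> \<not> P 0"
      using W[of "-1"] W[of 1] W[of 2] X[of 1] by (auto simp: next_row_def)
    then show ?thesis
      using 3 by (simp add: stone_vec_def turn_vector_def)
  next
    case 4
    then have "next_row P H 1 \<and> \<not> next_row P H (-1) \<and> \<not> P 0"
      using W[of "-1"] W[of 2] by (auto simp: next_row_def)
    then show ?thesis
      using 4 by (simp add: stone_vec_def turn_vector_def)
  qed
qed

lemma next_row_shift: "next_row (\<lambda>i. P (c + i)) (\<lambda>i. H (c + i)) i = next_row P H (c + i)"
  by (simp add: next_row_def algebra_simps)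

lemma stone_vec_jump:
  assumes "good P H" "fixed P H" "stone_vec P H i \<noteq> 0"
  shows "stone_vec (next_row P H) P (i + stone_vec P H i) = turn_vector (stone_vec P H i)"
proof -
  have "next_row (\<lambda>j. P (i + j)) (\<lambda>j. H (i + j)) = (\<lambda>j. next_row P H (i + j))"
    by (simp add: fun_eq_iff next_row_shift)
  then show ?thesis
    using stone_vec_jump_at[OF good_shift[OF assms(1)] fixed_shift[OF assms(2)], of i] assms(3)
    by (simp add: stone_vec_shift)
qed

text \<open>Each end of a run in the next row comes from an old stone whose vector points there; the
  four cases are the four possible vectors.\<close>

lemma stone_vec_jump_surj_at:
  assumes "good P H" "fixed P H" "stone_vec (next_row P H) P 0 \<noteq> 0"
  shows "\<exists>i. stone_vec P H i \<noteq> 0 \<and> i + stone_vec P H i = 0"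
proof -
  have "(next_row P H 0 \<and> \<not> next_row P H (-2)) \<or> (next_row P H (-1) \<and> \<not> next_row P H 1)"
    using assms(3) by (auto simp: stone_vec_def split: if_splits)
  then have "(P (-2) \<and> \<not> P 0 \<and> \<not> H 0 \<and> \<not> P (-1)) \<or> (P (-3) \<and> \<not> P (-1) \<and> H (-1) \<and> \<not> P (-2))
      \<or> (P 1 \<and> \<not> P (-1) \<and> \<not> H (-1)) \<or> (P 2 \<and> \<not> P 0 \<and> H 0)"
    using good_window[OF assms(1), of "-3"] good_window[OF assms(1), of "-2"]
      good_window[OF assms(1), of "-1"] good_window[OF assms(1), of "0"] good_window[OF assms(1), of "1"]
      good_window[OF assms(1), of "2"] fixed_window[OF assms(2), of "0"] fixed_window[OF assms(2), of "-1"]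
    unfolding next_row_def
    by (simp del: de_Morgan_disj de_Morgan_conj) satx
  then consider "stone_vec P H (-1) = 1" | "stone_vec P H (-2) = 2" | "stone_vec P H 1 = -1" | "stone_vec P H 2 = -2"
    by (auto simp: stone_vec_def)
  then show ?thesis
  proof cases
    case 1
    then show ?thesis by (intro exI[of _ "-1"]) simp
  next
    case 2
    then show ?thesis by (intro exI[of _ "-2"]) simp
  next
    case 3
    then show ?thesis by (intro exI[of _ "1"]) simp
  next
    case 4
    then show ?thesis by (intro exI[of _ "2"]) simp
  qed
qed

lemma stone_vec_jump_surj:
  assumes "good P H" "fixed P H" "stone_vec (next_row P H) P j \<noteq> 0"
  shows "\<exists>i. stone_vec P H i \<noteq> 0 \<and> i + stone_vec P H i = j"
proof -
  have "next_row (\<lambda>i. P (j + i)) (\<lambda>i. H (j + i)) = (\<lambda>i. next_row P H (j + i))"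
    by (simp add: fun_eq_iff next_row_shift)
  then obtain i where "stone_vec P H (j + i) \<noteq> 0" "i + stone_vec P H (j + i) = 0"
    using stone_vec_jump_surj_at[OF good_shift[OF assms(1)] fixed_shift[OF assms(2)], of j] assms(3)
    by (auto simp: stone_vec_shift)
  then show ?thesis
    by (intro exI[of _ "j + i"]) simp
qed

text \<open>Stones at 0 and 3 that face each other mean that -1 and 3 lie in \<open>P\<close> and 1
  does not. A hole at 1 is then one that \<open>fixH\<close> drops, which shortens both vectors from
  2 to 1.\<close>

lemma stone_vec_fixH_at:
  assumes "good P H"
  shows "stone_vec P (fixH P H) 0 =
    (if stone_vec P H 0 > 0 \<and> stone_vec P H 3 < 0 \<or> stone_vec P H 0 < 0 \<and> stone_vec P H (-3) > 0
     then sgn (stone_vec P H 0) else stone_vec P H 0)"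
proof -
  have "\<not> (P 0 \<and> P (-1))"
    using good_window[OF assms, of "-1"] by auto
  moreover have pos: "stone_vec P H 3 < 0 \<longleftrightarrow> P 3 \<and> \<not> P 1" "stone_vec P H (-3) > 0 \<longleftrightarrow> P (-4) \<and> \<not> P (-2)"
    using stone_vec_pos_iff[OF assms, of "-3"] by (simp_all add: stone_vec_neg_iff)
  ultimately show ?thesis
    unfolding pos by (auto simp: stone_vec_def fixH_def)
qed

lemma stone_vec_fixH:
  assumes "good P H"
  shows "stone_vec P (fixH P H) i =
    (if stone_vec P H i > 0 \<and> stone_vec P H (i + 3) < 0 \<or> stone_vec P H i < 0 \<and> stone_vec P H (i - 3) > 0
     then sgn (stone_vec P H i) else stone_vec P H i)"
proof -
  have "fixH (\<lambda>j. P (i + j)) (\<lambda>j. H (i + j)) = (\<lambda>j. fixH P H (i + j))"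
    by (simp add: fixH_def fun_eq_iff algebra_simps)
  then show ?thesis
    using stone_vec_fixH_at[OF good_shift[OF assms], of i] by (simp add: stone_vec_shift)
qed

section \<open>Distances between consecutive stones\<close>

lemma offset_simps:
  fixes x :: int
  shows "x - 3 - 1 = x - 4" "x - 3 + 1 = x - 2" "x - 3 + 2 = x - 1" "x - 3 + 4 = x + 1"
    "x - 2 - 2 = x - 4" "x - 2 - 1 = x - 3" "x - 2 + 1 = x - 1" "x - 2 + 3 = x + 1"
    "x - 2 + 4 = x + 2" "x - 1 - 3 = x - 4" "x - 1 - 2 = x - 3" "x - 1 - 1 = x - 2"
    "x - 1 + 2 = x + 1" "x - 1 + 3 = x + 2" "x - 1 + 4 = x + 3" "x + 1 - 3 = x - 2"
    "x + 1 - 2 = x - 1" "x + 1 + 1 = x + 2" "x + 1 + 2 = x + 3" "x + 1 + 3 = x + 4"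
    "x + 1 + 4 = x + 5" "x + 2 - 4 = x - 2" "x + 2 - 3 = x - 1" "x + 2 - 1 = x + 1"
    "x + 2 + 1 = x + 3" "x + 2 + 2 = x + 4" "x + 2 + 3 = x + 5" "x + 2 + 4 = x + 6"
    "x + 3 - 2 = x + 1" "x + 3 - 1 = x + 2" "x + 3 + 1 = x + 4" "x + 3 + 2 = x + 5"
    "x + 3 + 3 = x + 6" "x + 4 - 3 = x + 1" "x + 4 - 2 = x + 2" "x + 4 - 1 = x + 3"
  by simp_all

text \<open>The run is followed in steps of 2 until it ends; the next stone sits one past its last
  element, hence at odd distance.\<close>

lemma stone_after_arc:
  assumes "good P H"
  shows "P i \<Longrightarrow> stone_vec P H (i + int d) \<noteq> 0 \<Longrightarrow> 0 < d \<Longrightarrow>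
    (\<And>e. 0 < e \<Longrightarrow> e < d \<Longrightarrow> stone_vec P H (i + int e) = 0) \<Longrightarrow>
    0 < stone_vec P H (i + int d) \<and> odd d"
proof (induction d arbitrary: i rule: less_induct)
  case (less d)
  note W = good_window[OF assms]
  show ?case
  proof (cases "P (i + 2)")
    case True
    have "stone_vec P H (i + 1) = 0" "stone_vec P H (i + 2) = 0"
      using True less.prems(1) W[of i] by (simp_all add: stone_vec_def offset_simps)
    then have "d \<noteq> 1" "d \<noteq> 2"
      using less.prems(2) by auto
    define e where "e = d - 2"
    have e: "d = e + 2" "0 < e"
      using \<open>d \<noteq> 1\<close> \<open>d \<noteq> 2\<close> less.prems(3) by (auto simp: e_def)
    have "0 < stone_vec P H (i + 2 + int e) \<and> odd e"
    proof (rule less.IH)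
      show "stone_vec P H (i + 2 + int e') = 0" if "0 < e'" "e' < e" for e'
        using less.prems(4)[of "e' + 2"] that e by (simp add: algebra_simps)
    qed (use e True less.prems(2) in \<open>simp_all add: algebra_simps\<close>)
    then show ?thesis
      using e by (simp add: algebra_simps)
  next
    case False
    have s: "0 < stone_vec P H (i + 1)"
      using False less.prems(1) W[of i] by (simp add: stone_vec_def offset_simps)
    then have "d = 1"
      using less.prems(3) less.prems(4)[of 1] by (cases "1 < d") auto
    then show ?thesis
      using s by simp
  qed
qed

text \<open>Holes are followed in steps of 2 until an element of \<open>P\<close> comes at distance
  2 or 3 from the last one. The stone there has length 2 or 1 respectively, which makes distance
  plus length even.\<close>

lemma stone_after_hole:
  assumes "good P H"
  shows "H i \<Longrightarrow> stone_vec P H (i + int d) \<noteq> 0 \<Longrightarrow> 0 < d \<Longrightarrow>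
    (\<And>e. 0 < e \<Longrightarrow> e < d \<Longrightarrow> stone_vec P H (i + int e) = 0) \<Longrightarrow>
    stone_vec P H (i + int d) < 0 \<and> even (int d + \<bar>stone_vec P H (i + int d)\<bar>) \<and> 2 \<le> d \<and> (d = 2 \<longrightarrow> P (i + 2))"
proof (induction d arbitrary: i rule: less_induct)
  case (less d)
  note W = good_window[OF assms]
  have nP: "\<not> P i" "\<not> P (i + 1)" "\<not> H (i + 1)"
    using less.prems(1) W[of i] W[of "i + 1"] by auto
  then have s1: "stone_vec P H (i + 1) = 0"
    by (simp add: stone_vec_def)
  then have "d \<noteq> 1"
    using less.prems(2) by auto
  consider "H (i + 2)" "\<not> P (i + 2)" | "P (i + 2)" | "P (i + 3)" "\<not> P (i + 2)"
    using less.prems(1) W[of i] by blast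
  then show ?case
  proof cases
    case 1
    then have "stone_vec P H (i + 2) = 0"
      using nP by (simp add: stone_vec_def offset_simps)
    then have "d \<noteq> 2"
      using less.prems(2) by auto
    define e where "e = d - 2"
    have e: "d = e + 2" "0 < e"
      using \<open>d \<noteq> 1\<close> \<open>d \<noteq> 2\<close> less.prems(3) by (auto simp: e_def)
    have "stone_vec P H (i + 2 + int e) < 0 \<and> even (int e + \<bar>stone_vec P H (i + 2 + int e)\<bar>) \<and> 2 \<le> e \<and>
        (e = 2 \<longrightarrow> P (i + 2 + 2))"
    proof (rule less.IH)
      show "stone_vec P H (i + 2 + int e') = 0" if "0 < e'" "e' < e" for e'
        using less.prems(4)[of "e' + 2"] that e by (simp add: algebra_simps)
    qed (use e 1 less.prems(2) in \<open>simp_all add: algebra_simps\<close>)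
    then show ?thesis
      using e by (simp add: algebra_simps)
  next
    case 2
    then have s: "stone_vec P H (i + 2) = -2"
      using nP less.prems(1) by (simp add: stone_vec_def offset_simps)
    then have "d = 2"
      using less.prems(3) less.prems(4)[of 2] \<open>d \<noteq> 1\<close> by (cases "2 < d") auto
    then show ?thesis
      using s 2 by simp
  next
    case 3
    then have "stone_vec P H (i + 2) = 0"
      using nP by (simp add: stone_vec_def offset_simps)
    then have "d \<noteq> 2"
      using less.prems(2) by auto
    have s: "stone_vec P H (i + 3) = -1"
      using nP 3 by (simp add: stone_vec_def offset_simps)
    then have "d = 3"
      using less.prems(3) less.prems(4)[of 3] \<open>d \<noteq> 1\<close> \<open>d \<noteq> 2\<close> by (cases "3 < d") auto
    then show ?thesis
      using s by simp
  qed
qed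

lemma consecutive_stones:
  assumes good: "good P H" and fixed: "fixed P H"
    and s: "stone_vec P H i \<noteq> 0" "stone_vec P H (i + int d) \<noteq> 0" "0 < d"
    and between: "\<And>e. 0 < e \<Longrightarrow> e < d \<Longrightarrow> stone_vec P H (i + int e) = 0"
  shows "stone_vec P H i < 0 \<Longrightarrow> 0 < stone_vec P H (i + int d) \<and> odd d"
    and "0 < stone_vec P H i \<Longrightarrow> stone_vec P H (i + int d) < 0 \<and>
      odd (int d + \<bar>stone_vec P H i\<bar> + \<bar>stone_vec P H (i + int d)\<bar>) \<and> 3 \<le> d \<and>
      (d = 3 \<longrightarrow> \<bar>stone_vec P H i\<bar> = 1 \<and> \<bar>stone_vec P H (i + int d)\<bar> = 1)"
proof -
  note W = good_window[OF good]
  show "0 < stone_vec P H (i + int d) \<and> odd d" if "stone_vec P H i < 0"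
    using stone_after_arc[OF good _ s(2,3) between] that by (simp add: stone_vec_neg_iff)
  assume "0 < stone_vec P H i"
  then have P: "P (i - 1)" "\<not> P (i + 1)"
    using stone_vec_pos_iff[OF good] by auto
  then have nP: "\<not> P i"
    using W[of "i - 1"] by auto
  show "stone_vec P H (i + int d) < 0 \<and>
      odd (int d + \<bar>stone_vec P H i\<bar> + \<bar>stone_vec P H (i + int d)\<bar>) \<and> 3 \<le> d \<and>
      (d = 3 \<longrightarrow> \<bar>stone_vec P H i\<bar> = 1 \<and> \<bar>stone_vec P H (i + int d)\<bar> = 1)"
  proof (cases "H (i + 1)")
    case True
    have v: "stone_vec P H i = 2"
      using P nP True by (simp add: stone_vec_def)
    have "stone_vec P H (i + 1) = 0"
      using P nP by (simp add: stone_vec_def)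
    then have "d \<noteq> 1"
      using s(2) by auto
    define e where "e = d - 1"
    have e: "d = e + 1" "0 < e"
      using \<open>d \<noteq> 1\<close> s(3) by (auto simp: e_def)
    have "stone_vec P H (i + 1 + int e) < 0 \<and> even (int e + \<bar>stone_vec P H (i + 1 + int e)\<bar>) \<and> 2 \<le> e \<and>
        (e = 2 \<longrightarrow> P (i + 1 + 2))"
    proof (rule stone_after_hole[OF good])
      show "stone_vec P H (i + 1 + int e') = 0" if "0 < e'" "e' < e" for e'
        using between[of "e' + 1"] that e by (simp add: algebra_simps)
    qed (use e True s(2) in \<open>simp_all add: algebra_simps\<close>)
    \<comment> \<open>An element of \<open>P\<close> at \<open>i + 3\<close> would enclose the hole
      at \<open>i + 1\<close> together with \<open>i - 1\<close>, which fixedness excludes. So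
      distance 3 does not occur with the vector 2.\<close>
    moreover have "\<not> P (i + 3)"
      using fixed_window[OF fixed, of "i + 1"] True P by (simp add: algebra_simps)
    ultimately show ?thesis
      using e v by (auto simp: algebra_simps)
  next
    case False
    have v: "stone_vec P H i = 1"
      using P nP False by (simp add: stone_vec_def)
    have z: "stone_vec P H (i + 1) = 0"
      using P nP by (simp add: stone_vec_def)
    have far: "H (i + 2) \<or> P (i + 3)" "\<not> P (i + 2)"
      using W[of "i - 1"] W[of "i + 2"] P False by (auto simp: offset_simps)
    have z2: "stone_vec P H (i + 2) = 0"
      using P nP far by (simp add: stone_vec_def offset_simps)
    have "d \<noteq> 1" "d \<noteq> 2"
      using s(2) z z2 by auto
    show ?thesis
    proof (cases "H (i + 2)")
      case True
      define e where "e = d - 2"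
      have e: "d = e + 2" "0 < e"
        using \<open>d \<noteq> 1\<close> \<open>d \<noteq> 2\<close> s(3) by (auto simp: e_def)
      have "stone_vec P H (i + 2 + int e) < 0 \<and> even (int e + \<bar>stone_vec P H (i + 2 + int e)\<bar>) \<and> 2 \<le> e \<and>
          (e = 2 \<longrightarrow> P (i + 2 + 2))"
      proof (rule stone_after_hole[OF good])
        show "stone_vec P H (i + 2 + int e') = 0" if "0 < e'" "e' < e" for e'
          using between[of "e' + 2"] that e by (simp add: algebra_simps)
      qed (use e True s(2) in \<open>simp_all add: algebra_simps\<close>)
      then show ?thesis
        using e v by (auto simp: algebra_simps)
    next
      case 2: False
      then have w: "stone_vec P H (i + 3) = -1"
        using far P False by (simp add: stone_vec_def offset_simps)
      then have "d = 3"
        using between[of 3] \<open>d \<noteq> 1\<close> \<open>d \<noteq> 2\<close> s(3) by (cases "3 < d") auto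
      then show ?thesis
        using v w by simp
    qed
  qed
qed

text \<open>A good state can be read off clockwise from its stones, starting at any one of them; hence it is
  determined by them.\<close>

lemma next_mark:
  assumes "good P H"
  shows "P (i + 3) \<longleftrightarrow> stone_vec P H (i + 3) < 0 \<or> P (i + 1) \<and> \<not> 0 < stone_vec P H (i + 2)"
    and "H (i + 3) \<longleftrightarrow> \<not> P (i + 3) \<and>
      (H (i + 1) \<and> \<not> stone_vec P H (i + 4) < 0 \<or> P (i + 1) \<and> stone_vec P H (i + 2) = 2 \<or>
       P i \<and> stone_vec P H (i + 1) = 1 \<and> \<not> stone_vec P H (i + 4) < 0)"
proof -
  note W = good_window[OF assms]
  show *: "P (i + 3) \<longleftrightarrow> stone_vec P H (i + 3) < 0 \<or> P (i + 1) \<and> \<not> 0 < stone_vec P H (i + 2)"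
    unfolding stone_vec_pos_iff[OF assms] stone_vec_neg_iff by (auto simp: offset_simps)
  have s2: "stone_vec P H (i + 2) = 2 \<longleftrightarrow> P (i + 1) \<and> H (i + 3)"
    using W[of "i + 1"] W[of "i + 3"] by (auto simp: stone_vec_def offset_simps)
  have s1: "stone_vec P H (i + 1) = 1 \<longleftrightarrow> P i \<and> \<not> P (i + 2) \<and> \<not> H (i + 2)"
    using W[of i] by (auto simp: stone_vec_def offset_simps)
  have s4: "stone_vec P H (i + 4) < 0 \<longleftrightarrow> P (i + 4) \<and> \<not> P (i + 2)"
    by (simp add: stone_vec_neg_iff offset_simps)
  show "H (i + 3) \<longleftrightarrow> \<not> P (i + 3) \<and>
      (H (i + 1) \<and> \<not> stone_vec P H (i + 4) < 0 \<or> P (i + 1) \<and> stone_vec P H (i + 2) = 2 \<or>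
       P i \<and> stone_vec P H (i + 1) = 1 \<and> \<not> stone_vec P H (i + 4) < 0)"
    unfolding s1 s2 s4
    using W[of i] W[of "i + 1"] W[of "i + 2"] W[of "i + 3"] W[of "i + 4"]
    unfolding offset_simps add_diff_cancel diff_add_cancel by satx
qed

text \<open>Three consecutive columns are enough to start the recursion of \<open>next_mark\<close>,
  which computes the marks at \<open>i + 3\<close> from those at \<open>i\<close> and
  \<open>i + 1\<close> and from the stones.\<close>

lemma marks_eq_upward:
  assumes "good P H" "good P' H'" and stone_vec: "stone_vec P H = stone_vec P' H'"
    and "\<And>j. j \<in> {i, i + 1, i + 2} \<Longrightarrow> P j = P' j \<and> H j = H' j"
  shows "P (i + int m) = P' (i + int m) \<and> H (i + int m) = H' (i + int m)"
proof (induction m rule: less_induct)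
  case (less m)
  show ?case
  proof (cases "m < 3")
    case True
    then have "m = 0 \<or> m = 1 \<or> m = 2"
      by auto
    then show ?thesis
      using assms(4) by auto
  next
    case False
    define k where "k = m - 3"
    have m: "m = k + 3"
      using False by (simp add: k_def)
    have IH: "P (i + int k) = P' (i + int k)" "H (i + int k) = H' (i + int k)"
      "P (i + int k + 1) = P' (i + int k + 1)" "H (i + int k + 1) = H' (i + int k + 1)"
      using less.IH[of k] less.IH[of "k + 1"] m by (simp_all add: ac_simps)
    have "P (i + int k + 3) = P' (i + int k + 3)"
      unfolding next_mark(1)[OF assms(1)] next_mark(1)[OF assms(2)] IH stone_vec ..
    moreover from this have "H (i + int k + 3) = H' (i + int k + 3)"
      unfolding next_mark(2)[OF assms(1)] next_mark(2)[OF assms(2)] IH stone_vec by simp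
    ultimately show ?thesis
      by (simp add: m add.assoc)
  qed
qed

text \<open>The sign of the vector locates an end of a run, its length tells whether there is a hole
  at distance 2, and goodness excludes other marks nearby. This fixes the columns
  \<open>i - 2\<close> to \<open>i\<close> or \<open>i - 1\<close> to \<open>i + 1\<close>.\<close>

lemma marks_eq_at_stone:
  assumes "good P H" "good P' H'" and stone_vec: "stone_vec P H = stone_vec P' H'" and "stone_vec P H i \<noteq> 0"
  shows "\<exists>i. \<forall>j\<in>{i, i + 1, i + 2}. P j = P' j \<and> H j = H' j"
proof (cases "stone_vec P H i < 0")
  case True
  have P: "P i" "\<not> P (i - 2)" "P' i" "\<not> P' (i - 2)"
    using True stone_vec stone_vec_neg_iff[of P H i] stone_vec_neg_iff[of P' H' i] by simp_all
  have "H (i - 2) \<longleftrightarrow> stone_vec P H i = -2" "H' (i - 2) \<longleftrightarrow> stone_vec P' H' i = -2"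
    using P by (simp_all add: stone_vec_def)
  then have "H (i - 2) = H' (i - 2)"
    using stone_vec by simp
  then have "\<forall>j\<in>{i - 2, i - 2 + 1, i - 2 + 2}. P j = P' j \<and> H j = H' j"
    using P good_window[OF assms(1), of i] good_window[OF assms(2), of i]
      good_window[OF assms(1), of "i - 1"] good_window[OF assms(2), of "i - 1"]
    by (auto simp: offset_simps)
  then show ?thesis
    by blast
next
  case False
  then have "0 < stone_vec P H i"
    using assms(4) by simp
  then have P: "P (i - 1)" "\<not> P (i + 1)" "P' (i - 1)" "\<not> P' (i + 1)"
    using stone_vec stone_vec_pos_iff[OF assms(1), of i] stone_vec_pos_iff[OF assms(2), of i] by simp_all
  moreover have nP: "\<not> P i" "\<not> P' i" "\<not> H i" "\<not> H' i" "\<not> H (i - 1)" "\<not> H' (i - 1)"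
    using P good_window[OF assms(1), of "i - 1"] good_window[OF assms(2), of "i - 1"] by auto
  moreover have "H (i + 1) \<longleftrightarrow> stone_vec P H i = 2" "H' (i + 1) \<longleftrightarrow> stone_vec P' H' i = 2"
    using P nP by (simp_all add: stone_vec_def)
  ultimately have "\<forall>j\<in>{i - 1, i - 1 + 1, i - 1 + 2}. P j = P' j \<and> H j = H' j"
    using stone_vec by (simp add: offset_simps)
  then show ?thesis
    by blast
qed

section \<open>Good states as necklaces\<close>

lemma rmod_of_int:
  fixes N :: nat
  assumes "0 < N"
  shows "real_of_int a rmod real N = real_of_int (a mod int N)"
proof (rule rmod_unique)
  show "real_of_int (a mod int N) \<in> {0..<\<bar>real N\<bar>}"
  proof -
    have "a mod int N < int N" "0 \<le> a mod int N"
      using assms by simp_all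
    then have "real_of_int (a mod int N) < real_of_int (int N)" "0 \<le> real_of_int (a mod int N)"
      by (simp_all only: of_int_less_iff of_int_0_le_iff)
    then show ?thesis
      by simp
  qed
  show "real_of_int a = real_of_int (a mod int N) + real_of_int (a div int N) * real N"
    by (metis mod_div_mult_eq of_int_add of_int_mult of_int_of_nat_eq)
qed

context even_cylinder begin

lemma periodic_add:
  assumes "periodic P"
  shows "P (i + n) = P i" "P (i + n + k) = P (i + k)" "P (i + n - k) = P (i - k)"
  by (rule periodic_eq_mod[OF assms]; simp add: eq_mod_dvd)+

lemma periodic_stone_vec: "periodic P \<Longrightarrow> periodic H \<Longrightarrow> periodic (stone_vec P H)"
  unfolding periodic_def[of "stone_vec P H"] by (simp add: stone_vec_def periodic_add)

lemma periodic_next_row: "periodic P \<Longrightarrow> periodic H \<Longrightarrow> periodic (next_row P H)"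
  unfolding periodic_def[of "next_row P H"] by (simp add: next_row_def periodic_add)

lemma periodic_fixH: "periodic P \<Longrightarrow> periodic H \<Longrightarrow> periodic (fixH P H)"
  unfolding periodic_def[of "fixH P H"] by (simp add: fixH_def periodic_add)

lemma count_period_shift:
  assumes "periodic Q"
  shows "count_period (\<lambda>i. Q (i + c)) = count_period Q"
  unfolding count_period_def
proof (rule bij_betw_same_card)
  show "bij_betw (\<lambda>i. (i + c) mod n) {i. 0 \<le> i \<and> i < n \<and> Q (i + c)} {i. 0 \<le> i \<and> i < n \<and> Q i}"
  proof (rule bij_betw_byWitness[where f' = "\<lambda>i. (i - c) mod n"])
    have "Q ((i - c) mod n + c) = Q i" for i
      by (rule periodic_eq_mod[OF assms]) (simp add: eq_mod_move)
    then show "(\<lambda>i. (i - c) mod n) ` {i. 0 \<le> i \<and> i < n \<and> Q i} \<subseteq> {i. 0 \<le> i \<and> i < n \<and> Q (i + c)}"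
      using n_pos by auto
  qed (use n_pos assms in \<open>auto simp: mod_simps\<close>)
qed

lemma count_period_split: "count_period Q = count_period (\<lambda>i. Q i \<and> R i) + count_period (\<lambda>i. Q i \<and> \<not> R i)"
proof -
  have "{i. 0 \<le> i \<and> i < n \<and> Q i} =
      {i. 0 \<le> i \<and> i < n \<and> Q i \<and> R i} \<union> {i. 0 \<le> i \<and> i < n \<and> Q i \<and> \<not> R i}"
    by auto
  then show ?thesis
    unfolding count_period_def by (subst card_Un_disjoint[symmetric]) (auto simp: finite_period)
qed

text \<open>The number of runs of \<open>P\<close>, counted by their last elements; it is the
  parameter \<open>k\<close> of the necklace. A row that continues in steps of 2 all the way round
  has none.\<close>

definition arcs :: "(int \<Rightarrow> bool) \<Rightarrow> nat" where
  "arcs P = count_period (\<lambda>i. P i \<and> \<not> P (i + 2))"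

definition stones :: "(int \<Rightarrow> bool) \<Rightarrow> (int \<Rightarrow> bool) \<Rightarrow> stone set" where
  "stones P H = (\<lambda>i. (real_of_int i, stone_vec P H i)) ` {i. 0 \<le> i \<and> i < n \<and> stone_vec P H i \<noteq> 0}"

text \<open>Every run has a negative stone at its first element and a positive one after its last.
  First and last elements are equinumerous, since in both cases the rest of \<open>P\<close> counts
  the pairs at distance 2.\<close>

lemma card_stones:
  assumes "good P H" "periodic P"
  shows "card (stones P H) = 2 * arcs P"
proof -
  have "card (stones P H) = count_period (\<lambda>i. stone_vec P H i \<noteq> 0)"
    unfolding stones_def count_period_def by (rule card_image) (simp add: inj_on_def)
  also have "\<dots> = count_period (\<lambda>i. stone_vec P H i \<noteq> 0 \<and> stone_vec P H i < 0) + count_period (\<lambda>i. stone_vec P H i \<noteq> 0 \<and> \<not> stone_vec P H i < 0)"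
    by (rule count_period_split)
  also have "(\<lambda>i. stone_vec P H i \<noteq> 0 \<and> stone_vec P H i < 0) = (\<lambda>i. P i \<and> \<not> P (i - 2))"
    by (rule ext) (metis stone_vec_neg_iff less_irrefl)
  also have "(\<lambda>i. stone_vec P H i \<noteq> 0 \<and> \<not> stone_vec P H i < 0) = (\<lambda>i. P (i - 1) \<and> \<not> P (i - 1 + 2))"
  proof
    show "(stone_vec P H i \<noteq> 0 \<and> \<not> stone_vec P H i < 0) = (P (i - 1) \<and> \<not> P (i - 1 + 2))" for i
      using stone_vec_pos_iff[OF assms(1), of i] by (auto simp: offset_simps)
  qed
  also have "count_period (\<lambda>i. P (i - 1) \<and> \<not> P (i - 1 + 2)) = arcs P"
    unfolding arcs_def using count_period_shift[of "\<lambda>i. P i \<and> \<not> P (i + 2)" "-1"] assms(2)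
    by (simp add: periodic_def[of "\<lambda>i. P i \<and> \<not> P (i + 2)"] periodic_add)
  also have "count_period (\<lambda>i. P i \<and> \<not> P (i - 2)) = arcs P"
  proof -
    have "count_period (\<lambda>i. P i \<and> P (i - 2)) = count_period (\<lambda>i. P (i + 2) \<and> P (i + 2 - 2))"
      using assms(2) by (intro count_period_shift[symmetric]) (simp add: periodic_def[of "\<lambda>i. P i \<and> P (i - 2)"] periodic_add)
    then have "count_period (\<lambda>i. P i \<and> P (i - 2)) = count_period (\<lambda>i. P i \<and> P (i + 2))"
      by (simp add: conj_commute)
    then show ?thesis
      using count_period_split[of P "\<lambda>i. P (i - 2)"] count_period_split[of P "\<lambda>i. P (i + 2)"]
      by (simp add: arcs_def)
  qed
  finally show ?thesis
    by simp
qed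

lemma arc_stones: "arc N (real_of_int i, v) (real_of_int j, w) = real_of_int ((j - i) mod n)"
  using rmod_of_int[of N "j - i"] n_pos by (simp add: arc_def)

text \<open>Translates consecutive stones into integers: the clockwise arc has an integral length
  \<open>d\<close>, and a stone strictly inside it would be nearer to \<open>s\<close>.\<close>

lemma next_stone_stones:
  assumes per: "periodic P" "periodic H" and nx: "next_stone N (stones P H) s t"
  obtains i d where "s = (real_of_int i, stone_vec P H i)" "snd t = stone_vec P H (i + int d)"
    "arc N s t = real d" "0 < d" "stone_vec P H i \<noteq> 0" "stone_vec P H (i + int d) \<noteq> 0"
    "\<And>e. 0 < e \<Longrightarrow> e < d \<Longrightarrow> stone_vec P H (i + int e) = 0"
proof -
  note p = periodic_stone_vec[OF per]
  obtain i j where i: "0 \<le> i" "i < n" "stone_vec P H i \<noteq> 0" "s = (real_of_int i, stone_vec P H i)"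
    and j: "0 \<le> j" "j < n" "stone_vec P H j \<noteq> 0" "t = (real_of_int j, stone_vec P H j)"
    using nx by (auto simp: next_stone_def stones_def)
  define d where "d = nat ((j - i) mod n)"
  have d: "int d = (j - i) mod n"
    using n_pos by (simp add: d_def)
  have "i \<noteq> j"
    using nx i j by (auto simp: next_stone_def)
  have "\<not> eq_mod j i"
    using eq_mod_range i j \<open>i \<noteq> j\<close> by metis
  then have "(j - i) mod n \<noteq> 0"
    by (simp add: eq_mod_dvd dvd_eq_mod_eq_0)
  then have "0 < d"
    using d by (cases d) auto
  have "eq_mod (i + int d) j"
    by (simp add: d eq_mod_def mod_simps)
  then have sj: "stone_vec P H (i + int d) = stone_vec P H j"
    by (rule periodic_eq_mod[OF p])
  have a: "arc N s t = real d"
    unfolding i(4) j(4) arc_stones d[symmetric] by simp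
  have "stone_vec P H (i + int e) = 0" if e: "0 < e" "e < d" for e
  proof (rule ccontr)
    assume nz: "stone_vec P H (i + int e) \<noteq> 0"
    have "int e < n"
      using e d n_pos by (metis less_trans of_nat_less_iff pos_mod_bound)
    let ?u = "(real_of_int ((i + int e) mod n), stone_vec P H ((i + int e) mod n))"
    have "?u \<in> stones P H"
      using nz n_pos p unfolding stones_def by (intro imageI) simp
    moreover have "?u \<noteq> s"
    proof
      assume "?u = s"
      then have "eq_mod (i + int e) i"
        using i by (simp add: eq_mod_def)
      then show False
        using \<open>int e < n\<close> e(1) by (auto simp: eq_mod_dvd dest: zdvd_imp_le)
    qed
    ultimately have "arc N s t \<le> arc N s ?u"
      using nx by (simp add: next_stone_def)
    also have "arc N s ?u = real e"
      unfolding i(4) arc_stones using \<open>int e < n\<close> by (simp add: mod_simps)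
    finally show False
      using a e by simp
  qed
  then show ?thesis
    using that[of i d] i j a sj \<open>0 < d\<close> by simp
qed

lemma necklace_stones:
  assumes per: "periodic P" "periodic H" and good: "good P H" and fixed: "fixed P H"
  shows "necklace (arcs P) N (stones P H)"
  unfolding necklace_def
proof (intro conjI ballI allI impI)
  show "finite (stones P H)"
    unfolding stones_def by (intro finite_imageI finite_period)
  show "card (stones P H) = 2 * arcs P"
    by (rule card_stones[OF good per(1)])
  show "inj_on fst (stones P H)"
    by (auto simp: inj_on_def stones_def)
  fix s t
  show "0 \<le> fst s" "fst s < real N" "snd s \<in> {- 2, - 1, 1, 2}" if s: "s \<in> stones P H"
  proof -
    obtain i where i: "0 \<le> i" "i < n" "stone_vec P H i \<noteq> 0" "s = (real_of_int i, stone_vec P H i)"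
      using s by (auto simp: stones_def)
    have "real_of_int i < real_of_int n"
      using i(2) by (simp only: of_int_less_iff)
    then show "0 \<le> fst s" "fst s < real N" "snd s \<in> {- 2, - 1, 1, 2}"
      using i stone_vec_range[of P H i] by auto
  qed
  assume "next_stone N (stones P H) s t"
  then obtain i d
    where s: "s = (real_of_int i, stone_vec P H i)" "snd t = stone_vec P H (i + int d)"
      "arc N s t = real d" "0 < d" "stone_vec P H i \<noteq> 0" "stone_vec P H (i + int d) \<noteq> 0"
      and between: "\<And>e. 0 < e \<Longrightarrow> e < d \<Longrightarrow> stone_vec P H (i + int e) = 0"
    by (rule next_stone_stones[OF per]) (rule that)
  note C = consecutive_stones[OF good fixed s(5,6,4) between]
  show "sgn (snd t) = - sgn (snd s)"
    using C s(1,2,5) by (cases "stone_vec P H i < 0") (auto simp: sgn_if)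
  show "odd_integer (arc N s t)" if "face_away s t"
    using that C(1) s by (auto simp: face_away_def odd_integer_def intro!: exI[of _ "int d"])
  show "odd_integer (arc N s t + of_int \<bar>snd s\<bar> + of_int \<bar>snd t\<bar>)" if "face_towards s t"
    using that C(2) s unfolding odd_integer_def
    by (intro exI[of _ "int d + \<bar>snd s\<bar> + \<bar>snd t\<bar>"]) (auto simp: face_towards_def)
  show "3 \<le> arc N s t" if "face_towards s t"
    using that C(2) s by (auto simp: face_towards_def)
  show "\<bar>snd s\<bar> = 1" "\<bar>snd t\<bar> = 1" if "face_towards s t" "arc N s t = 3"
    using that C(2) s by (auto simp: face_towards_def)
qed

lemma turn_jump_image:
  "turn (jump N (stones P H)) =
    (\<lambda>i. (real_of_int ((i + stone_vec P H i) mod n), turn_vector (stone_vec P H i))) `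
      {i. 0 \<le> i \<and> i < n \<and> stone_vec P H i \<noteq> 0}"
  unfolding turn_def jump_def stones_def image_image
  using rmod_of_int[of N] n_pos by (auto simp flip: of_int_add intro!: image_cong)

lemma turn_jump_stones:
  assumes per: "periodic P" "periodic H" and good: "good P H" and fixed: "fixed P H"
  shows "turn (jump N (stones P H)) = stones (next_row P H) P"
proof -
  note p = periodic_stone_vec[OF per] and p' = periodic_stone_vec[OF periodic_next_row[OF per] per(1)]
  have nz: "turn_vector v \<noteq> 0" if "v \<noteq> 0" for v
    using that by (simp add: turn_vector_def)
  show ?thesis
  proof (intro equalityI subsetI)
    fix x assume "x \<in> turn (jump N (stones P H))"
    then obtain i where i: "stone_vec P H i \<noteq> 0" 
      "x = (real_of_int ((i + stone_vec P H i) mod n), turn_vector (stone_vec P H i))"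
      unfolding turn_jump_image by blast
    then show "x \<in> stones (next_row P H) P"
      using stone_vec_jump[OF good fixed i(1)] nz p' n_pos unfolding stones_def
      by (intro image_eqI[of _ _ "(i + stone_vec P H i) mod n"]) simp_all
  next
    fix x assume "x \<in> stones (next_row P H) P"
    then obtain j where j: "0 \<le> j" "j < n" "stone_vec (next_row P H) P j \<noteq> 0"
      "x = (real_of_int j, stone_vec (next_row P H) P j)"
      by (auto simp: stones_def)
    obtain i where i: "stone_vec P H i \<noteq> 0" "i + stone_vec P H i = j"
      using stone_vec_jump_surj[OF good fixed j(3)] by blast
    have "(i mod n + stone_vec P H (i mod n)) mod n = j"
      using i j p by (simp add: mod_simps)
    moreover have "turn_vector (stone_vec P H (i mod n)) = stone_vec (next_row P H) P j"
      using stone_vec_jump[OF good fixed i(1)] i(2) p by simp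
    ultimately show "x \<in> turn (jump N (stones P H))"
      unfolding turn_jump_image using i(1) p n_pos j(4) by (intro image_eqI[of _ _ "i mod n"]) simp_all
  qed
qed

text \<open>JUMP followed by TURN is injective on stones: the new vector determines the old one, and
  then the new position the old one. So the number of stones is preserved, and with it that of the
  runs.\<close>

lemma arcs_next_row:
  assumes per: "periodic P" "periodic H" and good: "good P H" and fixed: "fixed P H"
  shows "arcs (next_row P H) = arcs P"
proof -
  have turn_inj: "v = w" if "turn_vector v = turn_vector w" "v \<in> {-2, -1, 0, 1, 2}" "w \<in> {-2, -1, 0, 1, 2}" for v w
    using that by (auto simp: turn_vector_def)
  have "inj_on (\<lambda>i. (real_of_int ((i + stone_vec P H i) mod n), turn_vector (stone_vec P H i)))
      {i. 0 \<le> i \<and> i < n \<and> stone_vec P H i \<noteq> 0}"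
  proof (rule inj_onI, clarify)
    fix i j assume ij: "0 \<le> i" "i < n" "0 \<le> j" "j < n"
      and eq: "turn_vector (stone_vec P H i) = turn_vector (stone_vec P H j)"
        "real_of_int ((i + stone_vec P H i) mod n) = real_of_int ((j + stone_vec P H j) mod n)"
    have "stone_vec P H i = stone_vec P H j"
      using turn_inj[OF eq(1)] stone_vec_range by blast
    then have "eq_mod i j"
      using eq(2) by (simp add: eq_mod_def[symmetric])
    then show "i = j"
      using ij by (simp add: eq_mod_range)
  qed
  then have "card (turn (jump N (stones P H))) = count_period (\<lambda>i. stone_vec P H i \<noteq> 0)"
    unfolding turn_jump_image count_period_def by (rule card_image)
  also have "\<dots> = card (stones P H)"
    unfolding stones_def count_period_def by (rule card_image[symmetric]) (simp add: inj_on_def)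
  finally have "card (stones (next_row P H) P) = card (stones P H)"
    unfolding turn_jump_stones[OF assms] .
  then show ?thesis
    using card_stones[OF good_next_row[OF good fixed] periodic_next_row[OF per]] card_stones[OF good per(1)]
    by simp
qed

text \<open>If \<open>i\<close> ends a run, none of \<open>i + 1\<close>, \<open>i + 2\<close>,
  \<open>i + 3\<close> is in \<open>P\<close>. So the blocks of four columns starting at the ends of
  runs are pairwise disjoint.\<close>

lemma arcs_le:
  assumes "good P H" "periodic P"
  shows "4 * arcs P \<le> N"
proof -
  note W = good_window[OF assms(1)]
  define R where "R = {i. 0 \<le> i \<and> i < n \<and> P i \<and> \<not> P (i + 2)}"
  have gap: "i = i' \<and> j = j'"
    if "i \<in> R" "i' \<in> R" "j \<in> {0..3}" "j' \<in> {0..3}" "eq_mod (i + j) (i' + j')" "j \<le> j'" for i i' j j'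
  proof -
    have e: "eq_mod i (i' + (j' - j))"
      using that(5) by (simp add: eq_mod_dvd algebra_simps)
    then have P: "P i'" "P (i' + (j' - j))" "\<not> P (i' + 2)"
      using that(1,2) periodic_eq_mod[OF assms(2) e] by (auto simp: R_def)
    have "\<not> P (i' + 1)" "\<not> P (i' + 3)"
      using W[of i'] W[of "i' + 1"] W[of "i' + 2"] W[of "i' + 3"] P(1,3)
      by (auto simp: offset_simps)
    then have "j' - j \<noteq> 1" "j' - j \<noteq> 2" "j' - j \<noteq> 3"
      using P by auto
    then have "j' - j = 0"
      using that(3,4,6) by auto
    then show ?thesis
      using e that(1,2) by (simp add: R_def eq_mod_range)
  qed
  have "inj_on (\<lambda>(i, j). (i + j) mod n) (R \<times> {0..3})"
  proof (rule inj_onI)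
    fix x y assume xy: "x \<in> R \<times> {0..3}" "y \<in> R \<times> {0..3}"
      "(\<lambda>(i, j). (i + j) mod n) x = (\<lambda>(i, j). (i + j) mod n) y"
    obtain i j i' j' where ij: "x = (i, j)" "y = (i', j')"
      by (cases x, cases y)
    have "eq_mod (i + j) (i' + j')" "eq_mod (i' + j') (i + j)"
      using xy(3) by (simp_all add: ij eq_mod_def)
    moreover have "i \<in> R" "i' \<in> R" "j \<in> {0..3}" "j' \<in> {0..3}"
      using xy(1,2) by (simp_all add: ij)
    ultimately show "x = y"
      unfolding ij using gap[of i i' j j'] gap[of i' i j' j] linear[of j j'] by blast
  qed
  then have "card (R \<times> {0..3 :: int}) \<le> card {0..<n}"
    by (rule card_inj_on_le) (use n_pos in auto)
  then show ?thesis
    by (simp add: arcs_def count_period_def R_def card_cartesian_product)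
qed

lemma fix_stones_stones:
  assumes per: "periodic P" "periodic H" and good: "good P H" and "4 \<le> N"
  shows "fix_stones N (stones P H) = stones P (fixH P H)"
proof -
  note p = periodic_stone_vec[OF per]
  \<comment> \<open>As the circumference is at least 4, an arc of length 3 amounts to a difference
    congruent to 3.\<close>
  have arc3: "(i - j) mod n = 3 \<longleftrightarrow> eq_mod i (j + 3)" for i j
  proof -
    have "(i - j) mod n = 3 \<longleftrightarrow> (i - j) mod n = 3 mod n"
      using \<open>4 \<le> N\<close> by simp
    also have "\<dots> \<longleftrightarrow> eq_mod i (j + 3)"
      by (simp add: mod_eq_dvd_iff eq_mod_dvd algebra_simps)
    finally show ?thesis .
  qed
  have arc3': "arc N (real_of_int j, v) (real_of_int i, w) = 3 \<longleftrightarrow> eq_mod i (j + 3)" for i j v w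
    unfolding arc_stones arc3[symmetric] by linarith
  have close: "too_close N (stones P H) (real_of_int i, stone_vec P H i) \<longleftrightarrow>
      stone_vec P H i > 0 \<and> stone_vec P H (i + 3) < 0 \<or> stone_vec P H i < 0 \<and> stone_vec P H (i - 3) > 0" (is "?L \<longleftrightarrow> ?R") for i
  proof
    assume ?L
    then obtain j where "0 < stone_vec P H i \<and> stone_vec P H j < 0 \<and> eq_mod j (i + 3) \<or>
        stone_vec P H i < 0 \<and> 0 < stone_vec P H j \<and> eq_mod i (j + 3)"
      by (auto simp: too_close_def stones_def face_towards_def arc3')
    moreover have "eq_mod i (j + 3) \<longleftrightarrow> eq_mod j (i - 3)" for i j
      by (metis eq_mod_move(1) eq_mod_sym)
    ultimately show ?R
      using periodic_eq_mod[OF p, of j "i + 3"] periodic_eq_mod[OF p, of j "i - 3"] by auto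
  next
    assume ?R
    then show ?L
    proof (elim disjE conjE)
      assume "0 < stone_vec P H i" "stone_vec P H (i + 3) < 0"
      then show ?thesis
        unfolding too_close_def stones_def
        by (intro bexI[of _ "(real_of_int ((i + 3) mod n), stone_vec P H ((i + 3) mod n))"])
          (use p n_pos in \<open>auto simp: face_towards_def arc3'\<close>)
    next
      assume "stone_vec P H i < 0" "0 < stone_vec P H (i - 3)"
      moreover have "eq_mod i ((i - 3) mod n + 3)"
        by (simp add: eq_mod_def mod_simps)
      ultimately show ?thesis
        unfolding too_close_def stones_def
        by (intro bexI[of _ "(real_of_int ((i - 3) mod n), stone_vec P H ((i - 3) mod n))"])
          (use p n_pos in \<open>auto simp: face_towards_def arc3'\<close>)
    qed
  qed
  have nz: "stone_vec P (fixH P H) i = 0 \<longleftrightarrow> stone_vec P H i = 0" for i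
    by (simp add: stone_vec_def)
  show ?thesis
    unfolding fix_stones_def stones_def image_image
    by (intro image_cong) (auto simp: nz stone_vec_fixH[OF good] close[unfolded stones_def])
qed

lemma T_stones:
  assumes "periodic P" "periodic H" "good P H" "fixed P H" "4 \<le> N"
  shows "T N (stones P H) = stones (next_row P H) (fixH (next_row P H) P)"
  unfolding T_def turn_jump_stones[OF assms(1-4)]
  using assms by (intro fix_stones_stones periodic_next_row good_next_row)

lemma marks_eq:
  assumes "good P H" "good P' H'" "periodic P" "periodic H" "periodic P'" "periodic H'"
    and stone_vec: "stone_vec P H = stone_vec P' H'" and "stone_vec P H i \<noteq> 0"
  shows "P = P' \<and> H = H'"
proof -
  obtain a where a: "\<And>j. j \<in> {a, a + 1, a + 2} \<Longrightarrow> P j = P' j \<and> H j = H' j"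
    using marks_eq_at_stone[OF assms(1,2,7,8)] by metis
  have "P x = P' x \<and> H x = H' x" for x
  proof -
    define m where "m = nat ((x - a) mod n)"
    have "int m = (x - a) mod n"
      using n_pos by (simp add: m_def)
    then have "eq_mod x (a + int m)"
      by (simp add: eq_mod_def mod_simps)
    then show ?thesis
      using marks_eq_upward[OF assms(1,2,7), of a m] a periodic_eq_mod[of P x] periodic_eq_mod[of H x]
        periodic_eq_mod[of P' x] periodic_eq_mod[of H' x] assms(3-6) by simp
  qed
  then show ?thesis
    by auto
qed

text \<open>The isometry induces a rotation or reflection of the columns that matches the stones. By
  \<open>marks_eq\<close> it carries one state to the other, and the alternating sum is
  invariant.\<close>

lemma grid_sum_same_necklace:
  assumes good: "good P H" "good P' H'"
    and per: "periodic P" "periodic H" "periodic P'" "periodic H'"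
    and same: "same_necklace N (stones P' H') (stones P H)" and nz: "stone_vec P' H' a \<noteq> 0"
  shows "grid_sum m P' H' = grid_sum m P H"
proof -
  note p = periodic_stone_vec[OF per(1,2)] and p' = periodic_stone_vec[OF per(3,4)]
  obtain c and s :: int where s: "s = 1 \<or> s = -1" and
    eq: "stones P H = (\<lambda>(q, v). ((of_int s * q + c) rmod real N, s * v)) ` stones P' H'"
  proof -
    from same obtain c where "stones P H = rotate_stones N c (stones P' H') \<or>
        stones P H = reflect_stones N c (stones P' H')"
      by (auto simp: same_necklace_def)
    then show ?thesis
    proof
      assume "stones P H = rotate_stones N c (stones P' H')"
      then show ?thesis
        using that[of 1 c] by (simp add: rotate_stones_def)
    next
      assume "stones P H = reflect_stones N c (stones P' H')"
      then show ?thesis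
        using that[of "-1" c] by (simp add: reflect_stones_def)
    qed
  qed
  have mem: "(real_of_int (i mod n), stone_vec P' H' i) \<in> stones P' H'" if "stone_vec P' H' i \<noteq> 0" for i
    unfolding stones_def using that n_pos p' by (intro image_eqI[of _ _ "i mod n"]) simp_all
  \<comment> \<open>The isometry has a real parameter \<open>c\<close>; since it moves the stone at
    \<open>a\<close> to an integral position, \<open>c\<close> must be an integer.\<close>
  have "((of_int s * of_int (a mod n) + c) rmod real N, s * stone_vec P' H' a) \<in> stones P H"
    unfolding eq using mem[OF nz] by force
  then obtain b :: int where b: "(of_int s * of_int (a mod n) + c) rmod real N = of_int b"
    by (auto simp: stones_def)
  then have "[of_int s * of_int (a mod n) + c = of_int b] (rmod real N)"
    by (metis rcong_def rmod_rmod)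
  then obtain z where "of_int b = of_int s * of_int (a mod n) + c + of_int z * real N"
    by (auto simp: rcong_altdef)
  then have "c = real_of_int (b - s * (a mod n) - z * n)"
    by simp
  then obtain c0 where c0: "c = real_of_int c0"
    by blast
  have img: "stones P H = (\<lambda>i. (real_of_int ((s * i + c0) mod n), s * stone_vec P' H' i)) `
      {i. 0 \<le> i \<and> i < n \<and> stone_vec P' H' i \<noteq> 0}"
    unfolding eq stones_def[of P' H'] image_image c0
    using rmod_of_int[of N] n_pos by (auto simp flip: of_int_mult of_int_add intro!: image_cong)
  have ss: "s * (s * x) = x" for x
    using s by auto
  have lin: "eq_mod (s * i + c0) (s * j + c0) \<longleftrightarrow> eq_mod i j" for i j
    using s by (auto simp: eq_mod_dvd dvd_diff_commute)
  have fwd: "stone_vec P H (s * i + c0) = s * stone_vec P' H' i" if "stone_vec P' H' i \<noteq> 0" for i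
  proof -
    have "(real_of_int ((s * (i mod n) + c0) mod n), s * stone_vec P' H' (i mod n)) \<in> stones P H"
      unfolding img using that n_pos p' by (intro imageI) simp
    then have "stone_vec P H ((s * (i mod n) + c0) mod n) = s * stone_vec P' H' i"
      using p' by (auto simp: stones_def)
    moreover have "stone_vec P H ((s * (i mod n) + c0) mod n) = stone_vec P H (s * i + c0)"
      using periodic_eq_mod[OF p, of "s * (i mod n) + c0" "s * i + c0"] lin p by simp
    ultimately show ?thesis
      by simp
  qed
  have bwd: "stone_vec P H (s * i + c0) = 0" if "stone_vec P' H' i = 0" for i
  proof (rule ccontr)
    let ?j = "s * i + c0"
    assume "stone_vec P H ?j \<noteq> 0"
    then have "(real_of_int (?j mod n), stone_vec P H ?j) \<in> stones P H"
      unfolding stones_def using n_pos p by (intro image_eqI[of _ _ "?j mod n"]) simp_all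
    then obtain i' where i': "?j mod n = (s * i' + c0) mod n" "stone_vec P' H' i' \<noteq> 0"
      unfolding img by auto
    then have "eq_mod i i'"
      using lin by (simp add: eq_mod_def)
    then show False
      using periodic_eq_mod[OF p'] i'(2) that by metis
  qed
  have all: "s * stone_vec P H (s * i + c0) = stone_vec P' H' i" for i
    using fwd[of i] bwd[of i] s by (cases "stone_vec P' H' i = 0") auto
  from s show ?thesis
  proof
    assume [simp]: "s = 1"
    have "stone_vec (\<lambda>i. P (c0 + i)) (\<lambda>i. H (c0 + i)) = stone_vec P' H'"
    proof
      show "stone_vec (\<lambda>i. P (c0 + i)) (\<lambda>i. H (c0 + i)) i = stone_vec P' H' i" for i
        unfolding stone_vec_shift using all[of i] by (simp add: add.commute)
    qed
    moreover have "periodic (\<lambda>i. P (c0 + i))" "periodic (\<lambda>i. H (c0 + i))"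
      using periodic_shift(1)[OF per(1), of c0] periodic_shift(1)[OF per(2), of c0]
      by (simp_all add: add.commute)
    ultimately have "(\<lambda>i. P (c0 + i)) = P' \<and> (\<lambda>i. H (c0 + i)) = H'"
      using nz per by (intro marks_eq[OF good_shift[OF good(1)] good(2), of c0 a]) simp_all
    then show ?thesis
      using grid_sum_isometry[OF per(1,2), of 1 m c0] by (auto simp: add.commute)
  next
    assume [simp]: "s = -1"
    \<comment> \<open>The shift by one makes up for a run having its stones at its first element and
      one past its last.\<close>
    let ?P = "\<lambda>i. P (c0 - 1 - i)" and ?H = "\<lambda>i. H (c0 - 1 - i)"
    have "stone_vec ?P ?H = stone_vec P' H'"
    proof
      show "stone_vec ?P ?H i = stone_vec P' H' i" for i
        unfolding stone_vec_reflect[OF good(1)] using all[of i] by simp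
    qed
    moreover have "good ?P ?H"
    proof -
      have "good_at ?P ?H i" for i
        using good_window[OF good(1), of "c0 - 1 - i"] good_window[OF good(1), of "c0 - 1 - i - 1"]
          good_window[OF good(1), of "c0 - 1 - i - 3"]
        unfolding good_at_def by (simp add: algebra_simps) satx
      then show ?thesis
        by (simp add: good_def)
    qed
    ultimately have "?P = P' \<and> ?H = H'"
      using nz per periodic_shift(3)[of P "c0 - 1"] periodic_shift(3)[of H "c0 - 1"]
      by (intro marks_eq[OF _ good(2), of _ _ a]) simp_all
    then show ?thesis
      using grid_sum_isometry[OF per(1,2), of "-1" m "c0 - 1"] by (simp add: algebra_simps)
  qed
qed

end

section \<open>Denominators of the generating functions\<close>

text \<open>Rationality with denominator \<open>D\<close>, stated as a product to avoid division of
  power series.\<close>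

definition has_denom :: "rat poly \<Rightarrow> rat fps \<Rightarrow> bool" where
  "has_denom D f \<longleftrightarrow> (\<exists>h. fps_of_poly D * f = fps_of_poly h)"

lemma has_denom_poly: "has_denom D (fps_of_poly p)"
  unfolding has_denom_def by (intro exI[of _ "D * p"]) (simp add: fps_of_poly_mult)

lemma has_denom_add: "has_denom D f \<Longrightarrow> has_denom D g \<Longrightarrow> has_denom D (f + g)"
  unfolding has_denom_def by (metis distrib_left fps_of_poly_add)

lemma has_denom_diff: "has_denom D f \<Longrightarrow> has_denom D g \<Longrightarrow> has_denom D (f - g)"
  unfolding has_denom_def by (metis right_diff_distrib fps_of_poly_diff)

lemma has_denom_mult: "has_denom D f \<Longrightarrow> has_denom D (fps_of_poly p * f)"
  unfolding has_denom_def by (metis mult.left_commute fps_of_poly_mult)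

lemma has_denom_dvd:
  assumes "D dvd E" "has_denom D f"
  shows "has_denom E f"
proof -
  obtain C where "E = C * D"
    using assms(1) by (auto simp: dvd_def mult.commute)
  moreover obtain h where "fps_of_poly D * f = fps_of_poly h"
    using assms(2) by (auto simp: has_denom_def)
  ultimately have "fps_of_poly E * f = fps_of_poly (C * h)"
    by (simp add: fps_of_poly_mult mult.assoc)
  then show ?thesis
    by (auto simp: has_denom_def)
qed

lemma has_denom_factor: "has_denom D (fps_of_poly p * f) \<Longrightarrow> has_denom (D * p) f"
  by (simp add: has_denom_def fps_of_poly_mult mult.assoc)

text \<open>The relations between cylinder sums are used from two rows on; the first two
  coefficients only contribute a polynomial.\<close>

lemma has_denom_almost:
  assumes "\<And>m. 2 \<le> m \<Longrightarrow> fps_nth f m = fps_nth g m" "has_denom D g"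
  shows "has_denom D f"
proof -
  have "f - g = fps_of_poly [:fps_nth (f - g) 0, fps_nth (f - g) 1:]"
  proof (rule fps_ext)
    fix m :: nat
    consider "m = 0" | "m = 1" | "2 \<le> m" by linarith
    then show "fps_nth (f - g) m = fps_nth (fps_of_poly [:fps_nth (f - g) 0, fps_nth (f - g) 1:]) m"
      using assms(1) by cases (auto simp: coeff_pCons split: nat.split)
  qed
  then have "has_denom D (f - g)"
    using has_denom_poly by metis
  from has_denom_add[OF this assms(2)] show ?thesis
    by simp
qed

section \<open>Generating functions of states\<close>

context even_cylinder begin

definition grid_series :: "(int \<Rightarrow> bool) \<Rightarrow> (int \<Rightarrow> bool) \<Rightarrow> rat fps" where
  "grid_series P H = Abs_fps (\<lambda>m. of_int (grid_sum m P H))"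

definition den0 :: "rat poly" where
  "den0 = 1 - smult ((-1) ^ (N div 2)) (monom 1 2)"

text \<open>The factor with index \<open>j\<close> comes from the necklaces with
  \<open>Suc j\<close> pairs of stones; \<open>den0\<close> belongs to the alternating rows without
  stones.\<close>

definition den :: "nat \<Rightarrow> rat poly" where
  "den k = den0 * (\<Prod>j<k. 1 - monom 1 (2 * (N - 3 * Suc j)))"

lemma has_denom_den_mono: "j \<le> k \<Longrightarrow> has_denom (den j) f \<Longrightarrow> has_denom (den k) f"
  unfolding den_def
  by (erule has_denom_dvd[rotated]) (intro mult_dvd_mono dvd_refl prod_dvd_prod_subset; auto)

lemma grid_series_step:
  assumes per: "periodic P" "periodic H" and P: "\<And>i. P i \<Longrightarrow> \<not> P (i + 1) \<and> \<not> H i"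
  shows "has_denom D (grid_series P H - fps_of_poly (smult ((-1) ^ count_period P) (monom 1 1)) * grid_series (next_row P H) P)"
proof (rule has_denom_almost)
  fix m :: nat assume "2 \<le> m"
  then obtain k where k: "m = Suc k" "1 \<le> k"
    by (cases m) auto
  show "fps_nth (grid_series P H - fps_of_poly (smult ((-1) ^ count_period P) (monom 1 1)) * grid_series (next_row P H) P) m
      = fps_nth 0 m"
    using grid_sum_step[OF per P k(2)]
    by (simp add: grid_series_def k fps_of_poly_smult fps_of_poly_monom mult.assoc)
qed (use has_denom_poly[of D 0] in simp)

text \<open>In the application the last series belongs to a necklace with fewer stones: inserting \<open>p\<close> into \<open>P\<close>
  merges the two neighbouring runs.\<close>

lemma grid_series_unhole:
  assumes per: "periodic P" "periodic H" and "H p" "\<not> P p" "\<not> P (p - 1)" "\<not> P (p + 1)"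
  shows "has_denom D (grid_series P H - grid_series P (del_col p H) + grid_series (ins_col p P) (del_col p H))"
  by (rule has_denom_almost[of _ 0])
    (use grid_sum_unhole[OF assms] has_denom_poly[of D 0] in \<open>simp_all add: grid_series_def flip: of_int_add of_int_diff\<close>)

text \<open>Inserting \<open>p\<close> joins two runs: \<open>p - 2\<close> no longer ends a run,
  and \<open>p\<close> does not end one because \<open>p + 2\<close> is in \<open>P\<close>. This
  drives the induction on the number of runs.\<close>

lemma arcs_ins_col:
  assumes good: "good P H" and per: "periodic P" "periodic H"
    and p: "H p" "P (p - 2)" "P (p + 2)"
  shows "arcs (ins_col p P) < arcs P"
proof -
  let ?A = "\<lambda>P. {i. 0 \<le> i \<and> i < n \<and> P i \<and> \<not> P (i + 2)}"
  have "?A (ins_col p P) \<subset> ?A P"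
  proof (rule psubsetI)
    show "?A (ins_col p P) \<subseteq> ?A P"
    proof (rule subsetI)
      fix i assume "i \<in> ?A (ins_col p P)"
      then have i: "0 \<le> i" "i < n" "ins_col p P i" "\<not> ins_col p P (i + 2)"
        by simp_all
      have "\<not> eq_mod i p"
        using i(4) p(3) periodic_eq_mod[OF per(1), of "i + 2" "p + 2"] by (auto simp: ins_col_def)
      then show "i \<in> ?A P"
        using i by (auto simp: ins_col_def)
    qed
    have e: "eq_mod ((p - 2) mod n + 2) p"
      by (simp add: eq_mod_def mod_simps)
    have "\<not> P p"
      using good_window[OF good, of p] p(1) by auto
    then have "(p - 2) mod n \<in> ?A P"
      using n_pos p(2) per(1) periodic_eq_mod[OF per(1) e] by simp
    moreover have "(p - 2) mod n \<notin> ?A (ins_col p P)"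
      using e by (simp add: ins_col_def)
    ultimately show "?A (ins_col p P) \<noteq> ?A P"
      by blast
  qed
  then show ?thesis
    unfolding arcs_def count_period_def by (intro psubset_card_mono finite_period)
qed

text \<open>The offending holes are dropped one residue class at a time. Each removal leaves a
  correction term with fewer runs, covered by \<open>IH\<close>; the number of offending holes is
  the induction measure.\<close>

lemma grid_series_fixH:
  assumes IH: "\<And>P' H'. good P' H' \<Longrightarrow> periodic P' \<Longrightarrow> periodic H' \<Longrightarrow> arcs P' < arcs P \<Longrightarrow> has_denom D (grid_series P' H')"
    and "periodic P" "good P H" "periodic H"
  shows "has_denom D (grid_series P H - grid_series P (fixH P H))"
  using assms(3,4)
proof (induction "count_period (\<lambda>i. H i \<and> P (i - 2) \<and> P (i + 2))" arbitrary: H rule: less_induct)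
  case less
  note per = assms(2) less.prems(2)
  note W = good_window[OF less.prems(1)]
  show ?case
  proof (cases "\<exists>p. H p \<and> P (p - 2) \<and> P (p + 2)")
    case False
    then have "fixH P H = H"
      by (auto simp: fixH_def)
    then show ?thesis
      using has_denom_poly[of D 0] by simp
  next
    case True
    then obtain p where p: "H p" "P (p - 2)" "P (p + 2)"
      by blast
    have np: "\<not> P p" "\<not> P (p - 1)" "\<not> P (p + 1)"
      using W[of p] W[of "p - 1"] W[of "p + 1"] p by auto
    have R: "H i \<and> P (i - 2) \<and> P (i + 2)" if "eq_mod i p" for i
      using p periodic_eq_mod[OF per(1), of "i - 2" "p - 2"] periodic_eq_mod[OF per(1), of "i + 2" "p + 2"]
        periodic_eq_mod[OF per(2) that] that by simp
    have g: "good P (del_col p H)" "good (ins_col p P) (del_col p H)"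
      using good_unhole[OF less.prems(1), of "\<lambda>i. eq_mod i p"] R
      by (simp_all add: del_col_def[abs_def] ins_col_def[abs_def])
    have fix_eq: "fixH P (del_col p H) = fixH P H"
      using R by (auto simp: fixH_def del_col_def fun_eq_iff)
    have "count_period (\<lambda>i. del_col p H i \<and> P (i - 2) \<and> P (i + 2)) < count_period (\<lambda>i. H i \<and> P (i - 2) \<and> P (i + 2))"
      unfolding count_period_def
    proof (intro psubset_card_mono finite_period psubsetI)
      have "p mod n \<in> {c. 0 \<le> c \<and> c < n \<and> H c \<and> P (c - 2) \<and> P (c + 2)}"
        using R[of "p mod n"] n_pos by simp
      moreover have "p mod n \<notin> {c. 0 \<le> c \<and> c < n \<and> del_col p H c \<and> P (c - 2) \<and> P (c + 2)}"
        by (simp add: del_col_def)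
      ultimately show "{c. 0 \<le> c \<and> c < n \<and> del_col p H c \<and> P (c - 2) \<and> P (c + 2)} \<noteq>
          {c. 0 \<le> c \<and> c < n \<and> H c \<and> P (c - 2) \<and> P (c + 2)}"
        by blast
    qed (auto simp: del_col_def)
    then have 1: "has_denom D (grid_series P (del_col p H) - grid_series P (fixH P H))"
      using less.hyps[of "del_col p H"] g(1) per(2) fix_eq by simp
    have 2: "has_denom D (grid_series (ins_col p P) (del_col p H))"
      using IH[OF g(2)] per arcs_ins_col[OF less.prems(1) per p] by simp
    have 3: "has_denom D (grid_series P H - grid_series P (del_col p H) + grid_series (ins_col p P) (del_col p H))"
      by (rule grid_series_unhole[where p = p]) (use per p np in auto)
    show ?thesis
      using has_denom_add[OF has_denom_diff[OF 3 2] 1] by (simp add: algebra_simps)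
  qed
qed

section \<open>States without stones\<close>

lemma alternating:
  assumes per: "periodic Q" and Q: "Q a" "\<And>i. Q i \<Longrightarrow> Q (i + 2) \<and> \<not> Q (i + 1)"
  shows "Q = (\<lambda>i. even (i - a))"
proof -
  have up: "Q (a + 2 * int j)" for j
  proof (induction j)
    case (Suc j)
    then show ?case
      using Q(2)[of "a + 2 * int j"] by (simp add: algebra_simps)
  qed (use Q in simp)
  have ev: "Q x" if "even (x - a)" for x
  proof -
    define m where "m = nat ((x - a) mod n)"
    have m: "int m = (x - a) mod n"
      using n_pos by (simp add: m_def)
    have "even n"
      using N_even by simp
    then have "even ((x - a) mod n)"
      using that by (simp add: dvd_mod_iff)
    then obtain j where "m = 2 * j"
      using m by (metis even_of_nat evenE)
    moreover have "eq_mod x (a + int m)"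
      by (simp add: m eq_mod_def mod_simps)
    ultimately show ?thesis
      using up[of j] periodic_eq_mod[OF per, of x "a + int m"] by simp
  qed
  have "\<not> Q x" if "odd (x - a)" for x
    using ev[of "x - 1"] Q(2)[of "x - 1"] that by simp
  then show ?thesis
    using ev by auto
qed

text \<open>One step leads to an empty row with alternating holes, a second one back to the original
  row, rotated by one column. Only the first step carries the sign \<open>(-1) ^ (N div 2)\<close>;
  together they give \<open>den0\<close>.\<close>

lemma grid_series_alternating: "has_denom den0 (grid_series (\<lambda>i. even (i - a)) (\<lambda>_. False))"
proof -
  let ?E = "\<lambda>i. even (i - a)" and ?O = "\<lambda>_ :: int. False"
  have per: "periodic ?E" "periodic ?O"
    using N_even by (simp_all add: periodic_def)
  have "count_period ?E = N div 2"
  proof -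
    have "N = count_period (\<lambda>_. True)"
    proof -
      have "{c. 0 \<le> c \<and> c < n \<and> True} = {0..<n}"
        by auto
      then show ?thesis
        by (simp add: count_period_def)
    qed
    also have "\<dots> = count_period ?E + count_period (\<lambda>i. \<not> ?E i)"
      using count_period_split[of "\<lambda>_. True" ?E] by simp
    also have "(\<lambda>i. \<not> ?E i) = (\<lambda>i. ?E (i + 1))"
      by auto
    also have "count_period \<dots> = count_period ?E"
      by (rule count_period_shift[OF per(1)])
    finally show ?thesis
      by simp
  qed
  moreover have "next_row ?E ?O = ?O"
    by (auto simp: next_row_def)
  ultimately have 1: "has_denom D (grid_series ?E ?O - fps_of_poly (smult ((-1) ^ (N div 2)) (monom 1 1)) * grid_series ?O ?E)" for D
    using grid_series_step[OF per, of D] by simp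
  have "next_row ?O ?E = (\<lambda>i. ?E (i + 1))"
    by (auto simp: next_row_def)
  moreover have "count_period ?O = 0"
    by (simp add: count_period_def)
  moreover have "grid_series (\<lambda>i. ?E (i + 1)) ?O = grid_series ?E ?O"
    using grid_sum_isometry[OF per, of 1 _ 1] by (simp add: grid_series_def)
  ultimately have 2: "has_denom D (grid_series ?O ?E - fps_of_poly (monom 1 1) * grid_series ?E ?O)" for D
    using grid_series_step[OF per(2,1), of D] by simp
  let ?p = "smult ((-1) ^ (N div 2)) (monom 1 1) :: rat poly" and ?q = "monom 1 1 :: rat poly"
  have "den0 = 1 - ?p * ?q"
    by (simp add: den0_def mult_monom numeral_2_eq_2)
  then have den0: "fps_of_poly den0 = 1 - fps_of_poly ?p * fps_of_poly ?q"
    by (simp only: fps_of_poly_diff fps_of_poly_mult fps_of_poly_1)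
  have "(1 - p * q) * f = (f - p * g) + p * (g - q * f)" for p q f g :: "rat fps"
    by (simp add: algebra_simps)
  then have "fps_of_poly den0 * grid_series ?E ?O
      = (grid_series ?E ?O - fps_of_poly ?p * grid_series ?O ?E) + fps_of_poly ?p * (grid_series ?O ?E - fps_of_poly ?q * grid_series ?E ?O)"
    unfolding den0 .
  then have "has_denom 1 (fps_of_poly den0 * grid_series ?E ?O)"
    using has_denom_add[OF 1[of 1] has_denom_mult[OF 2[of 1], of ?p]] by (simp only:)
  then show ?thesis
    using has_denom_factor[of 1 den0] by simp
qed

text \<open>If no run ends, \<open>P\<close> is a full parity class or empty. In the first case no
  hole fits; in the second \<open>H\<close> is a parity class and one step leads to the first
  case.\<close>

lemma grid_series_no_arcs:
  assumes good: "good P H" and per: "periodic P" "periodic H" and "arcs P = 0"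
  shows "has_denom den0 (grid_series P H)"
proof -
  note W = good_window[OF good]
  have step: "P (i + 2)" if "P i" for i
  proof (rule ccontr)
    assume no: "\<not> P (i + 2)"
    have "P (i mod n + 2) = P (i + 2)"
      by (rule periodic_eq_mod[OF per(1)]) (simp add: eq_mod_def mod_simps)
    then have "i mod n \<in> {i. 0 \<le> i \<and> i < n \<and> P i \<and> \<not> P (i + 2)}"
      using n_pos per(1) that no by simp
    then show False
      using \<open>arcs P = 0\<close> finite_period[of "\<lambda>i. P i \<and> \<not> P (i + 2)"]
      unfolding arcs_def count_period_def card_eq_0_iff by blast
  qed
  show ?thesis
  proof (cases "\<exists>a. P a")
    case True
    then obtain a where "P a"
      by blast
    then have P: "P = (\<lambda>i. even (i - a))"
      using step W by (intro alternating[OF per(1)]) blast+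
    have "\<not> H i" for i
    proof (cases "P i")
      case False
      then have "P (i - 1)"
        by (simp add: P)
      then show ?thesis
        using W[of "i - 1"] by auto
    qed (use W in blast)
    then have "H = (\<lambda>_. False)"
      by auto
    then show ?thesis
      using grid_series_alternating P by simp
  next
    case False
    then have P: "P = (\<lambda>_. False)"
      by auto
    obtain a where "H a"
      using W[of 0] False by blast
    then have H: "H = (\<lambda>i. even (i - a))"
      using False W by (intro alternating[OF per(2)]) blast+
    have "next_row P H = (\<lambda>i. even (i - (a + 1)))"
      by (auto simp: next_row_def P H)
    then have "has_denom den0 (grid_series P H - fps_of_poly (smult ((-1) ^ count_period P) (monom 1 1)) *
        grid_series (\<lambda>i. even (i - (a + 1))) (\<lambda>_. False))"
      using grid_series_step[OF per, of den0] P by simp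
    from has_denom_add[OF this has_denom_mult[OF grid_series_alternating[of "a + 1"], of "smult ((-1) ^ count_period P) (monom 1 1)"]]
    show ?thesis
      by (simp only: diff_add_cancel)
  qed
qed

section \<open>Going round the cycle of a necklace\<close>

lemma grid_series_iterate:
  assumes IH: "\<And>P' H'. good P' H' \<Longrightarrow> periodic P' \<Longrightarrow> periodic H' \<Longrightarrow> arcs P' < arcs P \<Longrightarrow> has_denom D (grid_series P' H')"
    and "good P H" "fixed P H" "periodic P" "periodic H" "4 \<le> N"
  shows "\<exists>P' H' s. good P' H' \<and> fixed P' H' \<and> periodic P' \<and> periodic H' \<and> arcs P' = arcs P \<and>
    stones P' H' = (T N ^^ i) (stones P H) \<and> (s = 1 \<or> s = -1) \<and>
    has_denom D (grid_series P H - fps_of_poly (smult s (monom 1 i)) * grid_series P' H')"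
proof (induction i)
  case 0
  show ?case
    using assms has_denom_poly[of D 0] by (intro exI[of _ P] exI[of _ H] exI[of _ 1]) simp
next
  case (Suc i)
  then obtain P' H' s where
    S: "good P' H'" "fixed P' H'" "periodic P'" "periodic H'" and arcs: "arcs P' = arcs P"
    and st: "stones P' H' = (T N ^^ i) (stones P H)" and s: "s = 1 \<or> s = -1"
    and diff: "has_denom D (grid_series P H - fps_of_poly (smult s (monom 1 i)) * grid_series P' H')"
    by blast
  define Q where "Q = next_row P' H'"
  have Q: "good Q P'" "periodic Q" "arcs Q = arcs P"
    unfolding Q_def using S arcs by (simp_all add: good_next_row periodic_next_row arcs_next_row)
  define r :: rat where "r = (-1) ^ count_period P'"
  have r: "r = 1 \<or> r = -1"
    unfolding r_def by (cases "even (count_period P')") simp_all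
  have 1: "has_denom D (grid_series P' H' - fps_of_poly (smult r (monom 1 1)) * grid_series Q P')"
    unfolding r_def Q_def using S good_window[OF S(1)] by (intro grid_series_step) blast+
  have 2: "has_denom D (grid_series Q P' - grid_series Q (fixH Q P'))"
    using Q S(3) IH by (intro grid_series_fixH) simp_all
  let ?m = "fps_of_poly (smult s (monom 1 i))" and ?x = "fps_of_poly (smult r (monom 1 1))"
  have "fps_of_poly (smult (s * r) (monom 1 (Suc i))) = ?m * ?x"
    by (simp add: mult_monom mult.commute[of s] flip: fps_of_poly_mult)
  then have "grid_series P H - fps_of_poly (smult (s * r) (monom 1 (Suc i))) * grid_series Q (fixH Q P') =
      (grid_series P H - ?m * grid_series P' H') + ?m * ((grid_series P' H' - ?x * grid_series Q P') + ?x * (grid_series Q P' - grid_series Q (fixH Q P')))"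
    by (simp add: algebra_simps)
  then have "has_denom D (grid_series P H - fps_of_poly (smult (s * r) (monom 1 (Suc i))) * grid_series Q (fixH Q P'))"
    using has_denom_add[OF diff has_denom_mult[OF has_denom_add[OF 1 has_denom_mult[OF 2]]], of "smult s (monom 1 i)" "smult r (monom 1 1)"]
    by (simp only:)
  moreover have "stones Q (fixH Q P') = (T N ^^ Suc i) (stones P H)"
    using T_stones[OF S(3,4,1,2) assms(6)] st by (simp add: Q_def)
  moreover have "s * r = 1 \<or> s * r = -1"
    using s r by auto
  ultimately show ?case
    using Q S(3) by (intro exI[of _ Q] exI[of _ "fixH Q P'"] exI[of _ "s * r"])
      (simp add: good_fixH fixed_fixH periodic_fixH)
qed

text \<open>Strong induction on the number of runs. States with fewer runs supply the denominator
  \<open>den k\<close>, and the cycle of the necklace contributes one more factor.\<close>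

lemma grid_series_good:
  assumes cycle: "\<And>k X. 0 < k \<Longrightarrow> necklace k N X \<Longrightarrow> same_necklace N ((T N ^^ (N - 3 * k)) X) X"
  shows "good P H \<Longrightarrow> periodic P \<Longrightarrow> periodic H \<Longrightarrow> has_denom (den (arcs P)) (grid_series P H)"
proof (induction "arcs P" arbitrary: P H rule: less_induct)
  case less
  show ?case
  proof (cases "arcs P")
    case 0
    then show ?thesis
      using grid_series_no_arcs less.prems by (simp add: den_def)
  next
    case (Suc k)
    have IH: "has_denom (den k) (grid_series P' H')"
      if "good P' H'" "periodic P'" "periodic H'" "arcs P' < arcs P" for P' H'
      by (rule has_denom_den_mono[OF _ less.hyps]) (use that Suc in auto)
    have "4 \<le> N"
      using arcs_le[OF less.prems(1,2)] Suc by simp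
    \<comment> \<open>The state has to be fixed before \<open>necklace_stones\<close> applies; the
      difference is covered by \<open>grid_series_fixH\<close>.\<close>
    define K where "K = fixH P H"
    have K: "good P K" "fixed P K" "periodic K"
      unfolding K_def using less.prems by (simp_all add: good_fixH fixed_fixH periodic_fixH)
    define L where "L = N - 3 * arcs P"
    obtain P' K' s where S: "good P' K'" "fixed P' K'" "periodic P'" "periodic K'"
      and arcs: "arcs P' = arcs P" and st: "stones P' K' = (T N ^^ L) (stones P K)"
      and s: "s = 1 \<or> s = -1"
      and diff: "has_denom (den k) (grid_series P K - fps_of_poly (smult s (monom 1 L)) * grid_series P' K')"
      using grid_series_iterate[OF IH K(1,2) less.prems(2) K(3) \<open>4 \<le> N\<close>, of L] by blast
    have "card (stones P' K') \<noteq> 0"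
      using card_stones[OF S(1,3)] arcs Suc by simp
    then have "stones P' K' \<noteq> {}"
      by auto
    then obtain a where "stone_vec P' K' a \<noteq> 0"
      by (auto simp: stones_def)
    moreover have "same_necklace N (stones P' K') (stones P K)"
      unfolding st L_def
      using necklace_stones[OF less.prems(2) K(3,1,2)] Suc by (intro cycle) simp_all
    ultimately have "grid_series P' K' = grid_series P K"
      unfolding grid_series_def using grid_sum_same_necklace[OF K(1) S(1) less.prems(2) K(3) S(3,4)] by simp
    let ?m = "smult s (monom 1 L) :: rat poly"
    have ss: "s * s = 1"
      using s by auto
    \<comment> \<open>The sign \<open>s\<close> is not tracked; multiplying by \<open>1 + ?m\<close>
      gives a factor independent of it, which is why the exponent is doubled.\<close>
    have "1 - monom 1 (2 * L) = (1 + ?m) * (1 - ?m)"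
      using ss unfolding mult_2[of L] by (simp add: algebra_simps mult_monom)
    then have "fps_of_poly (1 - monom 1 (2 * L)) * grid_series P K
        = fps_of_poly (1 + ?m) * (grid_series P K - fps_of_poly ?m * grid_series P' K')"
      unfolding \<open>grid_series P' K' = grid_series P K\<close>
      by (simp only: fps_of_poly_mult fps_of_poly_diff fps_of_poly_1 mult.assoc left_diff_distrib mult_1_left)
    then have "has_denom (den k) (fps_of_poly (1 - monom 1 (2 * L)) * grid_series P K)"
      using has_denom_mult[OF diff] by simp
    then have 1: "has_denom (den (arcs P)) (grid_series P K)"
      using has_denom_factor[of "den k" "1 - monom 1 (2 * L)"] Suc
      by (simp add: den_def L_def mult.assoc)
    have "has_denom (den k) (grid_series P H - grid_series P K)"
      unfolding K_def using IH less.prems by (intro grid_series_fixH) simp_all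
    then have 2: "has_denom (den (arcs P)) (grid_series P H - grid_series P K)"
      using has_denom_den_mono[of k "arcs P"] Suc by simp
    show ?thesis
      using has_denom_add[OF 2 1] by simp
  qed
qed

section \<open>Decomposition of the full cylinder\<close>

lemma grid_series_branch:
  assumes "periodic P" "periodic H" "P p" "\<not> H p"
  shows "has_denom D (grid_series P H - grid_series (del_col p P) H + grid_series (del_col_near p P) (ins_col p H))"
  by (rule has_denom_almost[of _ 0])
    (use grid_sum_branch[OF assms] has_denom_poly[of D 0] in \<open>simp_all add: grid_series_def flip: of_int_add of_int_diff\<close>)

text \<open>Branching over the odd vertices of a full row leaves, for each set \<open>\<tau>\<close> of chosen columns, the even
  vertices that are not next to \<open>\<tau>\<close>, with holes at \<open>\<tau>\<close> in the row below. This is a good state except at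
  the pending columns, where an odd column outside \<open>\<tau>\<close> lies between two columns of \<open>\<tau>\<close>; such a column
  is afterwards either restored (put into \<open>K\<close>) or added to \<open>\<tau>\<close>.\<close>

definition row :: "(int \<Rightarrow> bool) \<Rightarrow> (int \<Rightarrow> bool) \<Rightarrow> int \<Rightarrow> bool" where
  "row \<tau> K i \<longleftrightarrow> even i \<and> \<not> \<tau> (i - 1) \<and> \<not> \<tau> (i + 1) \<or> K i"

lemma periodic_row: "periodic \<tau> \<Longrightarrow> periodic K \<Longrightarrow> periodic (row \<tau> K)"
  using N_even unfolding periodic_def[of "row \<tau> K"] by (simp add: row_def periodic_add)

lemma eq_mod_parity: "eq_mod i j \<Longrightarrow> even i \<longleftrightarrow> even j"
proof -
  assume "eq_mod i j"
  moreover have "2 dvd n"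
    using N_even by simp
  ultimately have "even (i - j)"
    unfolding eq_mod_dvd by (rule dvd_trans[rotated])
  then show ?thesis
    by simp
qed

definition pending :: "(int \<Rightarrow> bool) \<Rightarrow> (int \<Rightarrow> bool) \<Rightarrow> int \<Rightarrow> bool" where
  "pending \<tau> K i \<longleftrightarrow> odd i \<and> \<not> \<tau> i \<and> \<tau> (i - 2) \<and> \<tau> (i + 2) \<and> \<not> K i"

text \<open>When \<open>K\<close> holds exactly the odd columns outside \<open>\<tau>\<close>
  between two columns of \<open>\<tau>\<close>, the row depends only on \<open>\<tau>\<close> and
  parity, and goodness is a propositional check for each parity.\<close>

lemma good_row:
  assumes \<tau>: "\<And>i. \<tau> i \<Longrightarrow> odd i"
    and K: "\<And>i. K i \<longleftrightarrow> odd i \<and> \<not> \<tau> i \<and> \<tau> (i - 2) \<and> \<tau> (i + 2)"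
  shows "good (row \<tau> K) \<tau>"
  unfolding good_def
proof
  fix i
  have R: "row \<tau> K j \<longleftrightarrow> (if even j then \<not> \<tau> (j - 1) \<and> \<not> \<tau> (j + 1) else \<not> \<tau> j \<and> \<tau> (j - 2) \<and> \<tau> (j + 2))" for j
    using K[of j] by (auto simp: row_def)
  have no: "\<not> \<tau> j" if "even j" for j
    using \<tau>[of j] that by blast
  show "good_at (row \<tau> K) \<tau> i"
  proof (cases "even i")
    case True
    then show ?thesis
      unfolding good_at_def R offset_simps add_diff_cancel diff_add_cancel by (simp add: no) satx
  next
    case False
    then show ?thesis
      unfolding good_at_def R offset_simps add_diff_cancel diff_add_cancel by (simp add: no) satx
  qed
qed

context
  assumes cycle: "\<And>k X. 0 < k \<Longrightarrow> necklace k N X \<Longrightarrow> same_necklace N ((T N ^^ (N - 3 * k)) X) X"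
begin

text \<open>A pending column \<open>v\<close> is resolved by \<open>grid_series_unhole\<close> with
  \<open>v\<close> added to \<open>\<tau>\<close>: one term has \<open>v\<close> in
  \<open>\<tau>\<close>, the other has \<open>v\<close> restored to the row. Both have fewer pending
  columns, and without any the state is good.\<close>

lemma grid_series_row:
  assumes "periodic \<tau>" "periodic K"
    and "\<And>i. \<tau> i \<Longrightarrow> odd i" "\<And>i. K i \<Longrightarrow> odd i \<and> \<not> \<tau> i \<and> \<tau> (i - 2) \<and> \<tau> (i + 2)"
  shows "has_denom (den (N div 4)) (grid_series (row \<tau> K) \<tau>)"
  using assms
proof (induction "count_period (pending \<tau> K)" arbitrary: \<tau> K rule: less_induct)
  case less
  note per = less.prems(1,2) and odd = less.prems(3) and K = less.prems(4)
  show ?case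
  proof (cases "\<exists>v. pending \<tau> K v")
    case False
    then have "good (row \<tau> K) \<tau>"
      using odd K by (intro good_row) (auto simp: pending_def)
    moreover from this have "arcs (row \<tau> K) \<le> N div 4"
      using arcs_le[of "row \<tau> K" \<tau>] periodic_row[OF per] by simp
    ultimately show ?thesis
      using grid_series_good[OF cycle _ periodic_row[OF per] per(1)] has_denom_den_mono by blast
  next
    case True
    then obtain v where v: "odd v" "\<not> \<tau> v" "\<tau> (v - 2)" "\<tau> (v + 2)" "\<not> K v"
      by (auto simp: pending_def)
    have nv: "odd i \<and> \<not> \<tau> i \<and> \<tau> (i - 2) \<and> \<tau> (i + 2) \<and> \<not> K i" if "eq_mod i v" for i
      using v eq_mod_parity[OF that] periodic_eq_mod[OF per(1) that] periodic_eq_mod[OF per(2) that]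
        periodic_eq_mod[OF per(1), of "i - 2" "v - 2"] periodic_eq_mod[OF per(1), of "i + 2" "v + 2"] that
      by simp
    have less_count_period: "count_period Q < count_period (pending \<tau> K)"
      if "\<And>i. Q i \<Longrightarrow> pending \<tau> K i \<and> \<not> eq_mod i v" for Q
      unfolding count_period_def
    proof (intro psubset_card_mono finite_period psubsetI)
      have "v mod n \<in> {c. 0 \<le> c \<and> c < n \<and> pending \<tau> K c}"
        using nv[of "v mod n"] n_pos by (simp add: pending_def)
      moreover have "v mod n \<notin> {c. 0 \<le> c \<and> c < n \<and> Q c}"
        using that[of "v mod n"] by auto
      ultimately show "{c. 0 \<le> c \<and> c < n \<and> Q c} \<noteq> {c. 0 \<le> c \<and> c < n \<and> pending \<tau> K c}"
        by blast
    qed (use that in blast)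
    have 1: "has_denom (den (N div 4)) (grid_series (row (ins_col v \<tau>) K) (ins_col v \<tau>))"
    proof (rule less.hyps)
      show "count_period (pending (ins_col v \<tau>) K) < count_period (pending \<tau> K)"
      proof (rule less_count_period)
        fix i assume "pending (ins_col v \<tau>) K i"
        then show "pending \<tau> K i \<and> \<not> eq_mod i v"
          using nv[of "i - 2"] nv[of "i + 2"] by (auto simp: pending_def ins_col_def)
      qed
      show "odd i \<and> \<not> ins_col v \<tau> i \<and> ins_col v \<tau> (i - 2) \<and> ins_col v \<tau> (i + 2)" if "K i" for i
        using K[OF that] nv[of i] that by (auto simp: ins_col_def)
    qed (use per odd nv in \<open>auto simp: ins_col_def\<close>)
    have 2: "has_denom (den (N div 4)) (grid_series (row \<tau> (ins_col v K)) \<tau>)"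
    proof (rule less.hyps)
      show "count_period (pending \<tau> (ins_col v K)) < count_period (pending \<tau> K)"
        by (rule less_count_period) (auto simp: pending_def ins_col_def)
    qed (use per odd K nv in \<open>auto simp: ins_col_def\<close>)
    \<comment> \<open>The even neighbours of \<open>v\<close> are already blocked by
      \<open>v - 2\<close> and \<open>v + 2\<close>, so adding \<open>v\<close> to
      \<open>\<tau>\<close> does not alter the row.\<close>
    have row_eq: "row (ins_col v \<tau>) K = row \<tau> K" "ins_col v (row \<tau> K) = row \<tau> (ins_col v K)"
      "del_col v (ins_col v \<tau>) = \<tau>"
    proof -
      have "row (ins_col v \<tau>) K i = row \<tau> K i" for i
        using nv[of "i - 1"] nv[of "i + 1"] by (auto simp: row_def ins_col_def offset_simps)
      then show "row (ins_col v \<tau>) K = row \<tau> K"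
        by auto
      show "ins_col v (row \<tau> K) = row \<tau> (ins_col v K)"
        by (auto simp: ins_col_def row_def fun_eq_iff)
      show "del_col v (ins_col v \<tau>) = \<tau>"
        using nv by (auto simp: ins_col_def del_col_def fun_eq_iff)
    qed
    have noK: "\<not> K (v - 1)" "\<not> K (v + 1)"
      using K v(1) by fastforce+
    have "has_denom (den (N div 4)) (grid_series (row \<tau> K) (ins_col v \<tau>) - grid_series (row \<tau> K) (del_col v (ins_col v \<tau>)) +
        grid_series (ins_col v (row \<tau> K)) (del_col v (ins_col v \<tau>)))"
      using per v noK by (intro grid_series_unhole periodic_row periodic_del_col_ins_col)
        (auto simp: row_def ins_col_def offset_simps)
    then have 3: "has_denom (den (N div 4)) (grid_series (row \<tau> K) (ins_col v \<tau>) - grid_series (row \<tau> K) \<tau> + grid_series (row \<tau> (ins_col v K)) \<tau>)"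
      unfolding row_eq .
    have "grid_series (row \<tau> K) \<tau> = grid_series (row \<tau> K) (ins_col v \<tau>) + grid_series (row \<tau> (ins_col v K)) \<tau> -
        (grid_series (row \<tau> K) (ins_col v \<tau>) - grid_series (row \<tau> K) \<tau> + grid_series (row \<tau> (ins_col v K)) \<tau>)"
      by simp
    then show ?thesis
      using has_denom_diff[OF has_denom_add[OF 1[unfolded row_eq] 2] 3] by (simp only:)
  qed
qed

text \<open>\<open>U\<close> holds the odd columns not yet branched on. Branching at
  \<open>v\<close> either deletes it or moves it to \<open>\<tau>\<close>, which removes its even
  neighbours and makes a hole.\<close>

lemma grid_series_undecided:
  assumes "periodic \<tau>" "periodic U"
    and "\<And>i. \<tau> i \<Longrightarrow> odd i" "\<And>i. U i \<Longrightarrow> odd i \<and> \<not> \<tau> i"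
  shows "has_denom (den (N div 4)) (grid_series (row \<tau> U) \<tau>)"
  using assms
proof (induction "count_period U" arbitrary: \<tau> U rule: less_induct)
  case less
  note per = less.prems(1,2) and odd = less.prems(3) and U = less.prems(4)
  show ?case
  proof (cases "\<exists>v. U v")
    case False
    then show ?thesis
      using per odd by (intro grid_series_row) auto
  next
    case True
    then obtain v where v: "U v"
      by blast
    have odd_v: "odd i" if "eq_mod i v" for i
      using U[OF v] eq_mod_parity[OF that] by simp
    have "count_period (del_col v U) < count_period U"
      unfolding count_period_def
    proof (intro psubset_card_mono finite_period psubsetI)
      have "v mod n \<in> {c. 0 \<le> c \<and> c < n \<and> U c}"
        using v n_pos per(2) by simp
      moreover have "v mod n \<notin> {c. 0 \<le> c \<and> c < n \<and> del_col v U c}"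
        by (simp add: del_col_def)
      ultimately show "{c. 0 \<le> c \<and> c < n \<and> del_col v U c} \<noteq> {c. 0 \<le> c \<and> c < n \<and> U c}"
        by blast
    qed (auto simp: del_col_def)
    note IH = less.hyps[OF this]
    have 1: "has_denom (den (N div 4)) (grid_series (row \<tau> (del_col v U)) \<tau>)"
      by (rule IH) (use per odd U in \<open>auto simp: del_col_def\<close>)
    have 2: "has_denom (den (N div 4)) (grid_series (row (ins_col v \<tau>) (del_col v U)) (ins_col v \<tau>))"
      by (rule IH) (use per odd U odd_v in \<open>auto simp: del_col_def ins_col_def\<close>)
    have "del_col v (row \<tau> U) = row \<tau> (del_col v U)"
      using odd_v by (auto simp: del_col_def row_def fun_eq_iff)
    moreover have "del_col_near v (row \<tau> U) = row (ins_col v \<tau>) (del_col v U)"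
    proof
      fix i
      have e: "eq_mod i (v - 1) \<longleftrightarrow> eq_mod (i + 1) v" "eq_mod i (v + 1) \<longleftrightarrow> eq_mod (i - 1) v"
        by (simp_all add: eq_mod_move)
      show "del_col_near v (row \<tau> U) i = row (ins_col v \<tau>) (del_col v U) i"
        unfolding del_col_near_def row_def ins_col_def del_col_def e
        using odd_v[of i] odd_v[of "i + 1"] odd_v[of "i - 1"] U[of i] by (auto simp: ins_col_def)
    qed
    ultimately have 3: "has_denom (den (N div 4)) (grid_series (row \<tau> U) \<tau> - grid_series (row \<tau> (del_col v U)) \<tau> +
        grid_series (row (ins_col v \<tau>) (del_col v U)) (ins_col v \<tau>))"
      using grid_series_branch[of "row \<tau> U" \<tau> v] periodic_row[OF per] per U[OF v] v
      by (simp add: row_def[of \<tau> U v])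
    have "grid_series (row \<tau> U) \<tau> = (grid_series (row \<tau> U) \<tau> - grid_series (row \<tau> (del_col v U)) \<tau> +
        grid_series (row (ins_col v \<tau>) (del_col v U)) (ins_col v \<tau>)) + grid_series (row \<tau> (del_col v U)) \<tau> -
        grid_series (row (ins_col v \<tau>) (del_col v U)) (ins_col v \<tau>)"
      by simp
    then show ?thesis
      using has_denom_diff[OF has_denom_add[OF 3 1] 2] by (simp only:)
  qed
qed

lemma grid_series_full: "has_denom (den (N div 4)) (grid_series (\<lambda>_. True) (\<lambda>_. False))"
proof -
  \<comment> \<open>The start of the branching: no column is chosen and every odd one is undecided,
    which is the full row.\<close>
  have "row (\<lambda>_. False) odd = (\<lambda>_. True)"
    by (auto simp: row_def)
  moreover have "periodic (odd :: int \<Rightarrow> bool)"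
    using N_even by (simp add: periodic_def)
  ultimately show ?thesis
    using grid_series_undecided[of "\<lambda>_. False" odd] by (simp add: periodic_def)
qed

end

section \<open>The Cartesian product as a cylinder\<close>

lemma Z_grid: "Z (cart_prod (path_graph m) (cycle_graph N)) = grid_sum m (\<lambda>_. True) (\<lambda>_. False)"
proof -
  let ?G = "cart_prod (path_graph m) (cycle_graph N)"
  let ?\<phi> = "map_prod id int :: nat \<times> nat \<Rightarrow> nat \<times> int"
  let ?E = "\<lambda>x y. adj (?\<phi> x) (?\<phi> y)"
  have V: "fst ?G = {..<m} \<times> {..<N}"
    by (simp add: cart_prod_def path_graph_def cycle_graph_def)
  have edges: "snd ?G = {{(u, i), (u, Suc i mod N)} | u i. u < m \<and> i < N} \<union>
      {{(u, i), (Suc u, i)} | u i. Suc u < m \<and> i < N}" (is "_ = ?H \<union> ?V")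
  proof -
    have 1: "{{u} \<times> e | u e. u \<in> {..<m} \<and> e \<in> {{i, Suc i mod N} | i. i < N \<and> 2 \<le> N}} = ?H"
      (is "?L = _")
    proof (intro equalityI subsetI)
      fix x assume "x \<in> ?L"
      then obtain u i where "x = {u} \<times> {i, Suc i mod N}" "u < m" "i < N"
        by auto
      then show "x \<in> ?H"
        by blast
    next
      fix x assume "x \<in> ?H"
      then obtain u i where "x = {u} \<times> {i, Suc i mod N}" "u < m" "i < N"
        by blast
      then show "x \<in> ?L"
        using N_ge2 by blast
    qed
    have 2: "{e \<times> {v} | e v. e \<in> {{i, Suc i} | i. Suc i < m} \<and> v \<in> {..<N}} = ?V" (is "?L = _")
    proof (intro equalityI subsetI)
      fix x assume "x \<in> ?L"
      then obtain u i where "x = {u, Suc u} \<times> {i}" "Suc u < m" "i < N"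
        by auto
      then show "x \<in> ?V"
        by blast
    next
      fix x assume "x \<in> ?V"
      then obtain u i where "x = {u, Suc u} \<times> {i}" "Suc u < m" "i < N"
        by blast
      then show "x \<in> ?L"
        by blast
    qed
    show ?thesis
      unfolding cart_prod_def path_graph_def cycle_graph_def fst_conv snd_conv 1 2 ..
  qed
  have Suc_mod: "eq_mod (int a) (int b + 1) \<longleftrightarrow> a = Suc b mod N" if "a < N" for a b
  proof -
    have "eq_mod (int a) (int b + 1) \<longleftrightarrow> int (a mod N) = int (Suc b mod N)"
      by (simp add: eq_mod_def of_nat_mod add.commute)
    then show ?thesis
      using that by simp
  qed
  have "(\<forall>e\<in>snd ?G. \<not> e \<subseteq> \<sigma>) \<longleftrightarrow> indep ?E \<sigma>" if \<sigma>: "\<sigma> \<subseteq> fst ?G" for \<sigma>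
  proof
    assume L: "\<forall>e\<in>snd ?G. \<not> e \<subseteq> \<sigma>"
    have "\<not> ?E x y" if "x \<in> \<sigma>" "y \<in> \<sigma>" for x y
    proof
      assume "?E x y"
      obtain a b c d where xy: "x = (a, b)" "y = (c, d)"
        by (cases x, cases y)
      have bd: "a < m" "b < N" "c < m" "d < N"
        using \<sigma> that by (auto simp: V xy)
      consider "c = a" "b = Suc d mod N" | "c = a" "d = Suc b mod N" | "b = d" "a = Suc c" | "b = d" "c = Suc a"
        using \<open>?E x y\<close> Suc_mod[OF bd(2)] Suc_mod[OF bd(4)] by (auto simp: adj_def xy)
      then have "{x, y} \<in> snd ?G"
      proof cases
        case 1
        then have "{x, y} = {(c, d), (c, Suc d mod N)}"
          unfolding xy by blast
        then show ?thesis
          unfolding edges using bd by blast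
      next
        case 2
        then have "{x, y} = {(a, b), (a, Suc b mod N)}"
          unfolding xy by blast
        then show ?thesis
          unfolding edges using bd by blast
      next
        case 3
        then have "{x, y} = {(c, d), (Suc c, d)}"
          unfolding xy by blast
        then show ?thesis
          unfolding edges using bd 3 by blast
      next
        case 4
        then have "{x, y} = {(a, b), (Suc a, b)}"
          unfolding xy by blast
        then show ?thesis
          unfolding edges using bd 4 by blast
      qed
      with L have "\<not> {x, y} \<subseteq> \<sigma>"
        by (rule bspec)
      then show False
        using that by simp
    qed
    then show "indep ?E \<sigma>"
      by (simp add: indep_def)
  next
    assume R: "indep ?E \<sigma>"
    show "\<forall>e\<in>snd ?G. \<not> e \<subseteq> \<sigma>"
    proof (intro ballI notI)
      fix e assume e: "e \<in> snd ?G" "e \<subseteq> \<sigma>"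
      from e(1)[unfolded edges] consider u i where "e = {(u, i), (u, Suc i mod N)}" "i < N"
        | u i where "e = {(u, i), (Suc u, i)}"
        by (elim UnE CollectE exE conjE)
      then show False
      proof cases
        case 1
        then have "?E (u, Suc i mod N) (u, i)"
          using Suc_mod[of "Suc i mod N" i] by (simp add: adj_def)
        then show False
          using R[unfolded indep_def] e(2) unfolding 1(1) by (simp del: map_prod_simp)
      next
        case 2
        have "?E (u, i) (Suc u, i)"
          by (simp add: adj_def)
        then show False
          using R[unfolded indep_def] e(2) unfolding 2 by (simp del: map_prod_simp)
      qed
    qed
  qed
  then have "Ind ?G = {\<sigma>. \<sigma> \<subseteq> fst ?G \<and> indep ?E \<sigma>}"
    unfolding Ind_def by blast
  moreover have "{} \<notin> snd ?G"
    unfolding edges by auto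
  ultimately have "Z ?G = ind_sum ?E (fst ?G)"
    using Z_eq_sum_independent_sets[of ?G] by (simp add: ind_sum_def V)
  also have "\<dots> = ind_sum adj (?\<phi> ` fst ?G)"
    by (rule ind_sum_image[symmetric]) (auto simp: inj_on_def)
  also have "?\<phi> ` fst ?G = graph m (\<lambda>_. True) (\<lambda>_. False)"
  proof (intro equalityI subsetI)
    fix x assume "x \<in> graph m (\<lambda>_. True) (\<lambda>_. False)"
    then have "x = ?\<phi> (fst x, nat (snd x))" "(fst x, nat (snd x)) \<in> fst ?G"
      by (auto simp: graph_def V)
    then show "x \<in> ?\<phi> ` fst ?G"
      by (rule image_eqI)
  qed (auto simp: graph_def V)
  finally show ?thesis
    by (simp add: grid_sum_def)
qed

lemma f_series_eq: "f_series N = grid_series (\<lambda>_. True) (\<lambda>_. False)"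
  by (simp add: f_series_def grid_series_def Z_grid)

lemma fps_den:
  "fps_of_poly (den k) = (1 - fps_const ((-1) ^ (N div 2)) * fps_X ^ 2) *
    (\<Prod>j<k. 1 - fps_X ^ (2 * (N - 3 * Suc j)))"
  by (simp add: den_def den0_def fps_of_poly_mult fps_of_poly_diff fps_of_poly_prod
      fps_of_poly_smult fps_of_poly_monom')

end

section \<open>Rational form of the series\<close>

lemma f_series_0: "f_series 0 = Abs_fps (\<lambda>_. 1)"
proof -
  have "Ind (cart_prod (path_graph m) (cycle_graph 0)) = {{}}" for m
    by (auto simp: Ind_def cart_prod_def path_graph_def cycle_graph_def)
  then show ?thesis
    by (simp add: f_series_def Z_def euler_char_def)
qed

lemma has_denomD:
  assumes "has_denom D f" "poly D 0 \<noteq> 0"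
  shows "\<exists>h. f = fps_of_poly h / fps_of_poly D"
proof -
  obtain h where h: "fps_of_poly D * f = fps_of_poly h"
    using assms(1) by (auto simp: has_denom_def)
  have "fps_of_poly D \<noteq> 0"
    using assms(2) by auto
  then have "f = fps_of_poly D * f / fps_of_poly D"
    by simp
  then show ?thesis
    unfolding h by blast
qed

lemma (in even_cylinder) f_series_rational:
  assumes "\<And>k X. 0 < k \<Longrightarrow> necklace k N X \<Longrightarrow> same_necklace N ((T N ^^ (N - 3 * k)) X) X"
  shows "\<exists>h. f_series N = fps_of_poly h /
    ((1 - fps_const ((-1) ^ (N div 2)) * fps_X ^ 2) * (\<Prod>j<N div 4. 1 - fps_X ^ (2 * (N - 3 * Suc j))))"
proof -
  \<comment> \<open>All exponents are positive, so the truncated subtraction is genuine and every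
    factor has constant coefficient 1.\<close>
  have "3 * Suc j < 4 * q" if "j < q" for j q
    using that by simp
  then have "3 * Suc j < N" if "j < N div 4" for j
    using that div_times_less_eq_dividend[of N 4] by (metis mult.commute order_less_le_trans)
  then have "poly (den (N div 4)) 0 \<noteq> 0"
    by (simp add: den_def den0_def poly_prod poly_monom zero_power)
  then show ?thesis
    using has_denomD[OF grid_series_full[OF assms]] unfolding f_series_eq fps_den by simp
qed

theorem theorem7p6:
  fixes n :: nat
  assumes cycle_lengths:
    "\<And>(N::nat) (k::nat) X. even N \<Longrightarrow> N > 0 \<Longrightarrow> k > 0 \<Longrightarrow> necklace k N X \<Longrightarrow>
       same_necklace N ((T N ^^ (N - 3 * k)) X) X"
  shows
    "(\<exists>h :: rat poly.
        f_series (4 * n + 2) =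
          fps_of_poly h /
            ((1 + fps_X ^ 2) * (\<Prod>i<n. 1 - fps_X ^ (8 * n - 2 - 6 * i)))) \<and>
     (\<exists>h :: rat poly.
        f_series (4 * n) =
          fps_of_poly h /
            ((1 - fps_X ^ 2) * (\<Prod>i<n. 1 - fps_X ^ (8 * n - 6 - 6 * i))))"
proof (rule conjI)
  interpret even_cylinder "4 * n + 2"
    by unfold_locales simp_all
  have "(4 * n + 2) div 4 = n" "(4 * n + 2) div 2 = 2 * n + 1"
    by simp_all
  moreover have "2 * (4 * n + 2 - 3 * Suc i) = 8 * n - 2 - 6 * i" for i
    by simp
  \<comment> \<open>Half the circumference is odd here, which turns the first factor into
    \<open>1 + fps_X ^ 2\<close>.\<close>
  moreover have "fps_const ((-1) ^ (2 * n + 1)) = (-1 :: rat fps)"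
    by (simp flip: fps_const_neg)
  moreover have "\<exists>h. f_series (4 * n + 2) =
      fps_of_poly h / ((1 - fps_const ((-1) ^ ((4 * n + 2) div 2)) * fps_X ^ 2) *
        (\<Prod>j<(4 * n + 2) div 4. 1 - fps_X ^ (2 * (4 * n + 2 - 3 * Suc j))))"
    by (rule f_series_rational, rule cycle_lengths) simp_all
  ultimately show "\<exists>h :: rat poly. f_series (4 * n + 2) =
      fps_of_poly h / ((1 + fps_X ^ 2) * (\<Prod>i<n. 1 - fps_X ^ (8 * n - 2 - 6 * i)))"
    by (simp only: mult_minus_left mult_1_left diff_minus_eq_add)
next
  show "\<exists>h :: rat poly. f_series (4 * n) =
      fps_of_poly h / ((1 - fps_X ^ 2) * (\<Prod>i<n. 1 - fps_X ^ (8 * n - 6 - 6 * i)))"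
  \<comment> \<open>Circumference 0 lies outside the locale. All coefficients are 1 there, and the
    series is \<open>(1 + fps_X) / (1 - fps_X ^ 2)\<close>.\<close>
  proof (cases "n = 0")
    case True
    have "Abs_fps (\<lambda>_. 1 :: rat) = (1 + fps_X) / (1 - fps_X ^ 2)"
    proof -
      have "(1 - fps_X ^ 2 :: rat fps) = (1 + fps_X) * (1 - fps_X)"
        by (simp add: algebra_simps power2_eq_square)
      moreover have "(1 - fps_X :: rat fps) * Abs_fps (\<lambda>_. 1) = 1"
        by (rule fps_ext) (simp add: algebra_simps)
      ultimately have "(1 - fps_X ^ 2 :: rat fps) * Abs_fps (\<lambda>_. 1) = 1 + fps_X"
        by (simp only: mult.assoc mult_1_right)
      moreover have "(1 - fps_X ^ 2 :: rat fps) \<noteq> 0"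
      proof -
        have "fps_nth (1 - fps_X ^ 2 :: rat fps) 0 = 1"
          unfolding fps_sub_nth by simp
        then show ?thesis
          by (metis fps_zero_nth zero_neq_one)
      qed
      ultimately show ?thesis
        by (metis nonzero_mult_div_cancel_left)
    qed
    then show ?thesis
      using True f_series_0 by (intro exI[of _ "[:1, 1:]"]) (simp add: fps_of_poly_pCons)
  next
    case False
    interpret even_cylinder "4 * n"
      using False by unfold_locales simp_all
    have "4 * n div 4 = n" "4 * n div 2 = 2 * n"
      by simp_all
    moreover have "2 * (4 * n - 3 * Suc i) = 8 * n - 6 - 6 * i" for i
      by simp
    ultimately show ?thesis
      using f_series_rational[OF cycle_lengths] False by simp
  qed
qed

end
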